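(* Let $\mathrm{M}$ be a matroid on $[n]=\{1,\ldots,n\}$, let $c=(c_0,c_1,\ldots,c_n)$ be a strictly log-concave sequence of positive real numbers, and let $\alpha=(\alpha_0,\alpha_1,\ldots,\alpha_n)\in\mathbb{Z}_{\ge 0}^{n+1}$. If $\partial^\alpha \mathrm{Z}_{\mathrm{M},c}$ is not identically zero, then (i) the Hessian of $\partial^\alpha \mathrm{Z}_{\mathrm{M},c}$ is nonsingular for all $w\in\mathbb{R}^{n+1}_{>0}$ and $0<q\le 1$, and (ii) the Hessian of $\partial^\alpha \mathrm{Z}_{\mathrm{M},c}$ has exactly one positive eigenvalue for all $w\in\mathbb{R}^{n+1}_{>0}$ and $0<q\le 1$.
   Context: Let $n$ be an integer larger than $1$, and let $\mathrm{rk}_{\mathrm{M}}:2^{[n]}\to\mathbb{Z}_{\ge 0}$ be the rank function of $\mathrm{M}$. For a nonnegative integer $k$ and a positive real parameter $q$, define the degree $k$ homogeneous polynomial in $n$ variables $$\mathrm{Z}^k_{\mathrm{M}}=\mathrm{Z}^k_{\mathrm{M}}(q,w_1,\ldots,w_n)=\sum_{A} q^{-\mathrm{rk}_{\mathrm{M}}(A)}\prod_{i\in A}w_i,$$ where the sum is over all $k$-element subsets $A$ of $[n]$. A sequence $c=(c_0,c_1,\ldots,c_n)$ of $n+1$ positive real numbers is strictly log-concave if $c_m^2>c_{m-1}c_{m+1}$ for $0<m<n$. For such $c$, set $$\mathrm{Z}_{\mathrm{M},c}=\sum_{k=0}^n c_{n-k}\,\mathrm{Z}^{n-k}_{\mathrm{M}}\,w_0^k,$$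 a polynomial in $w=(w_0,w_1,\ldots,w_n)$. Write $\partial_i=\frac{\partial}{\partial w_i}$ and $\partial^\alpha=\partial_0^{\alpha_0}\partial_1^{\alpha_1}\cdots\partial_n^{\alpha_n}$. The Hessian of a polynomial $G$ in $w_0,\ldots,w_n$ is the matrix $\left(\frac{\partial^2 G}{\partial w_i\,\partial w_j}\right)_{i,j=0}^n$.
   Formalization: The formal theorem assumes |α| ≤ n−2 (otherwise a nonzero ∂^α Z has degree ≤ 1 and zero Hessian), and (i) concerns the Hessian in the variables that occur in ∂^α Z (if α_i = 1 for some i ≥ 1, the full Hessian has a zero row). *)

theory Defs
  imports
    "HOL-Analysis.Derivative"
    "Jordan_Normal_Form.Char_Poly"
    "Jordan_Normal_Form.DL_Submatrix"
begin

section \<open>Matroids and their rank functions\<close>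

definition matroid :: "'a set \<Rightarrow> 'a set set \<Rightarrow> bool" where
  "matroid E \<I> \<longleftrightarrow>
     finite E \<and> \<I> \<subseteq> Pow E \<and> {} \<in> \<I> \<and>
     (\<forall>X\<in>\<I>. \<forall>Y. Y \<subseteq> X \<longrightarrow> Y \<in> \<I>) \<and>
     (\<forall>X\<in>\<I>. \<forall>Y\<in>\<I>. card X < card Y \<longrightarrow> (\<exists>y\<in>Y - X. insert y X \<in> \<I>))"

definition matroid_rank :: "'a set set \<Rightarrow> 'a set \<Rightarrow> nat" where
  "matroid_rank \<I> A = Max (card ` {X \<in> \<I>. X \<subseteq> A})"

section \<open>The multivariate Tutte polynomial\<close>

text \<open>A polynomial in \<open>w\<^sub>0, \<dots>, w\<^sub>n\<close> is represented by the function that it induces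
  on \<^typ>\<open>nat \<Rightarrow> real\<close>; only the values of \<open>w\<close> at the indices \<open>0, \<dots>, n\<close> matter.
  Likewise, only the entries \<open>0, \<dots>, n\<close> of \<open>c\<close> and \<open>\<alpha>\<close> matter below.\<close>

definition Z_hom :: "nat \<Rightarrow> nat set set \<Rightarrow> nat \<Rightarrow> real \<Rightarrow> (nat \<Rightarrow> real) \<Rightarrow> real" where
  "Z_hom n \<I> k q w =
     (\<Sum>A \<in> {A. A \<subseteq> {1..n} \<and> card A = k}. q powi (- int (matroid_rank \<I> A)) * (\<Prod>i\<in>A. w i))"

definition Z_poly ::
    "nat \<Rightarrow> nat set set \<Rightarrow> (nat \<Rightarrow> real) \<Rightarrow> real \<Rightarrow> (nat \<Rightarrow> real) \<Rightarrow> real" where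
  "Z_poly n \<I> c q w = (\<Sum>k = 0..n. c (n - k) * Z_hom n \<I> (n - k) q w * w 0 ^ k)"

definition strictly_log_concave :: "nat \<Rightarrow> (nat \<Rightarrow> real) \<Rightarrow> bool" where
  "strictly_log_concave n c \<longleftrightarrow> (\<forall>m. 0 < m \<and> m < n \<longrightarrow> (c m)\<^sup>2 > c (m - 1) * c (m + 1))"

section \<open>Partial derivatives and Hessians\<close>

definition partial :: "nat \<Rightarrow> ((nat \<Rightarrow> real) \<Rightarrow> real) \<Rightarrow> (nat \<Rightarrow> real) \<Rightarrow> real" where
  "partial i f w = deriv (\<lambda>t. f (w(i := t))) (w i)"

definition partials :: "nat \<Rightarrow> (nat \<Rightarrow> nat) \<Rightarrow> ((nat \<Rightarrow> real) \<Rightarrow> real) \<Rightarrow> (nat \<Rightarrow> real) \<Rightarrow> real" where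
  "partials n \<alpha> f = foldr (\<lambda>i. partial i ^^ \<alpha> i) [0..<Suc n] f"

definition hessian :: "nat \<Rightarrow> ((nat \<Rightarrow> real) \<Rightarrow> real) \<Rightarrow> (nat \<Rightarrow> real) \<Rightarrow> real mat" where
  "hessian n f w = mat (n + 1) (n + 1) (\<lambda>(i, j). partial i (partial j f) w)"

text \<open>The indices of the variables that actually occur in \<open>f\<close>.  A variable that does not
  occur contributes a zero row and a zero column to \<^const>\<open>hessian\<close>, so nonsingularity is
  meaningful only for the Hessian with respect to the occurring variables.\<close>

definition occurring_vars :: "nat \<Rightarrow> ((nat \<Rightarrow> real) \<Rightarrow> real) \<Rightarrow> nat set" where
  "occurring_vars n f = {i. i \<le> n \<and> (\<exists>w t. f (w(i := t)) \<noteq> f w)}"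

definition reduced_hessian :: "nat \<Rightarrow> ((nat \<Rightarrow> real) \<Rightarrow> real) \<Rightarrow> (nat \<Rightarrow> real) \<Rightarrow> real mat" where
  "reduced_hessian n f w = submatrix (hessian n f w) (occurring_vars n f) (occurring_vars n f)"

text \<open>Eigenvalues are counted with multiplicity.\<close>

definition num_pos_eigenvalues :: "real mat \<Rightarrow> nat" where
  "num_pos_eigenvalues A = (\<Sum>x \<in> {x. 0 < x \<and> eigenvalue A x}. Polynomial.order x (char_poly A))"

end

theory Submission
  imports Defs "Jordan_Normal_Form.Schur_Decomposition"
begin

text \<open>With \<open>c' k = c k * (n - k)!\<close> the polynomial becomes the sum over \<open>A\<close> of
  \<open>c' |A| * q^(- rk A) * w^A * w\<^sub>0^m / m!\<close> with \<open>m = d - |A|\<close>.  The derivative by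
  \<open>w\<^sub>0\<close> only lowers the degree \<open>d\<close>, and the derivative by \<open>w\<^sub>i\<close> contracts \<open>i\<close> and shifts
  \<open>c'\<close>, so all nonzero partial derivatives are of the same shape.  By induction on \<open>d\<close>, the Hessian
  at a positive point \<open>w\<close> is negative definite on the orthogonal complement of \<open>w\<close> with respect to
  itself.  For \<open>d = 2\<close> one completes the square in \<open>w\<^sub>0\<close> and applies the Cauchy--Schwarz inequality
  over the parallel classes; strict log-concavity of \<open>c\<close> is what the remaining inequality needs.
  For \<open>d > 2\<close> Euler's identity writes the Hessian as a positive combination of the Hessians of the
  first derivatives, and the reversed Cauchy--Schwarz inequalities of the latter exclude eigenvalues
  of the suitably normalised Hessian between \<open>0\<close> and \<open>1\<close>, where \<open>1\<close> is its simple Perron--Frobenius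
  eigenvalue.\<close>

section \<open>Real bilinear forms on finite index sets\<close>

text \<open>Strict negativity on the complement of \<open>w\<close> is the one claim carried through
  the induction because both conclusions follow from it: a kernel vector is orthogonal to
  \<open>w\<close> with value 0, and two positive eigenvalues would span a plane meeting that
  complement. The obstacle is that \<open>w i\<close> with \<open>i > 0\<close> disappears from the
  derivative by \<open>w i\<close>, so that Hessian is degenerate in direction \<open>i\<close> and
  gives only a weak inequality over the common index set. The variable \<open>w 0\<close> repairs
  this: its derivative keeps all the other variables, and its row of the Hessian is positive, which
  also gives the connectedness behind Perron-Frobenius. Log-concavity is carried as
  \<open>(c' m)^2 * (N - m + 1) > c' (m - 1) * c' (m + 1) * (N - m)\<close> with
  \<open>N = card S\<close>. The factorials in \<open>c'\<close> turn strict log-concavity of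
  \<open>c\<close> into exactly this, and contraction lowers \<open>N\<close> and shifts
  \<open>m\<close> by one each, so \<open>N - m\<close> survives. At \<open>m = 1\<close> it beats
  the factor \<open>1 - 1/N\<close> that Cauchy-Schwarz over at most \<open>N\<close> parallel
  classes leaves. No spectral theorem enters the inductive step: a linear system is solved and
  Cauchy-Schwarz is applied to its solution.\<close>

definition bilin :: "'a set \<Rightarrow> ('a \<Rightarrow> 'a \<Rightarrow> real) \<Rightarrow> ('a \<Rightarrow> real) \<Rightarrow> ('a \<Rightarrow> real) \<Rightarrow> real" where
  "bilin V H x y = (\<Sum>i\<in>V. \<Sum>j\<in>V. H i j * x i * y j)"

lemma bilin_rows: "bilin V H x y = (\<Sum>i\<in>V. x i * (\<Sum>j\<in>V. H i j * y j))"
  by (simp add: bilin_def sum_distrib_left mult_ac)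

lemma bilin_commute:
  assumes "\<And>i j. i \<in> V \<Longrightarrow> j \<in> V \<Longrightarrow> H i j = H j i"
  shows "bilin V H x y = bilin V H y x"
proof -
  have "bilin V H x y = (\<Sum>j\<in>V. \<Sum>i\<in>V. H i j * x i * y j)"
    unfolding bilin_def by (rule sum.swap)
  also have "\<dots> = bilin V H y x"
    unfolding bilin_def by (intro sum.cong refl) (simp add: assms mult_ac)
  finally show ?thesis .
qed

lemma bilin_add_scaled_left:
  "bilin V H (\<lambda>i. x i + t * y i) z = bilin V H x z + t * bilin V H y z"
  by (simp add: bilin_def sum_distrib_left algebra_simps sum.distrib)

lemma bilin_add_scaled_right:
  "bilin V H z (\<lambda>i. x i + t * y i) = bilin V H z x + t * bilin V H z y"
  by (simp add: bilin_def sum_distrib_left algebra_simps sum.distrib)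

lemma bilin_add_scaled_self:
  assumes "\<And>i j. i \<in> V \<Longrightarrow> j \<in> V \<Longrightarrow> H i j = H j i"
  shows "bilin V H (\<lambda>i. x i + t * y i) (\<lambda>i. x i + t * y i) =
    bilin V H x x + 2 * t * bilin V H x y + t\<^sup>2 * bilin V H y y"
  using bilin_commute[of V H x y, OF assms]
  by (simp add: bilin_add_scaled_left bilin_add_scaled_right algebra_simps power2_eq_square)

lemma bilin_cong:
  assumes "\<And>i. i \<in> V \<Longrightarrow> x i = x' i" "\<And>i. i \<in> V \<Longrightarrow> y i = y' i"
  shows "bilin V H x y = bilin V H x' y'"
  unfolding bilin_def by (intro sum.cong refl) (simp add: assms)

lemma bilin_delta_right:
  assumes "finite V" "k \<in> V"
  shows "bilin V H x (\<lambda>i. if i = k then 1 else 0) = (\<Sum>i\<in>V. H i k * x i)"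
  using assms by (simp add: bilin_def if_distrib cong: if_cong)

lemma bilin_insert_self:
  assumes "finite F" "a \<notin> F" and sym: "\<And>i. i \<in> F \<Longrightarrow> M i a = M a i"
  shows "bilin (insert a F) M x x =
    M a a * (x a)\<^sup>2 + 2 * x a * (\<Sum>j\<in>F. M a j * x j) + bilin F M x x"
proof -
  have "(\<Sum>i\<in>F. M i a * x i * x a) = x a * (\<Sum>j\<in>F. M a j * x j)"
    unfolding sum_distrib_left by (intro sum.cong refl) (simp add: sym)
  then show ?thesis
    using assms(1,2)
    by (simp add: bilin_def sum.distrib power2_eq_square algebra_simps sum_distrib_left)
qed

text \<open>Zero rows and columns may be dropped. This compares the Hessian of a derivative by
  \<open>w i\<close> on \<open>S\<close> with the one on \<open>S - {i}\<close>, and the full matrix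
  on \<open>0..n\<close> with its block of occurring variables, without renumbering.\<close>

lemma bilin_restrict:
  assumes "finite V" "V' \<subseteq> V"
    and "\<And>i j. i \<in> V \<Longrightarrow> j \<in> V \<Longrightarrow> i \<notin> V' \<or> j \<notin> V' \<Longrightarrow> H i j = 0"
  shows "bilin V H x y = bilin V' H x y"
proof -
  have "bilin V H x y = (\<Sum>i\<in>V'. \<Sum>j\<in>V. H i j * x i * y j)"
    unfolding bilin_def using assms by (intro sum.mono_neutral_right) auto
  also have "\<dots> = bilin V' H x y"
    unfolding bilin_def using assms by (intro sum.cong refl sum.mono_neutral_right) auto
  finally show ?thesis .
qed

section \<open>Semidefinite forms and positive definite linear systems\<close>

text \<open>First-order condition for a maximum at \<open>t = 0\<close>.\<close>

lemma linear_coeff_zero_if_quadratic_nonpos: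
  fixes b c :: real
  assumes "\<And>t. 2 * t * b + t\<^sup>2 * c \<le> 0"
  shows "b = 0"
proof (rule ccontr)
  assume "b \<noteq> 0"
  \<comment> \<open>Small enough that \<open>\<bar>s * c\<bar> < 1\<close>, so at
    \<open>t = s * b\<close> the linear term dominates the quadratic one.\<close>
  define s where "s = 1 / (\<bar>c\<bar> + 1)"
  have s: "0 < s" "s * c < 1"
    by (auto simp: s_def divide_simps)
  have "2 * (s * b) * b + (s * b)\<^sup>2 * c = s * b\<^sup>2 * (2 + s * c)"
    by (simp add: power2_eq_square algebra_simps)
  moreover have "2 + s * c > 0"
    by (auto simp: s_def divide_simps)
  ultimately show False
    using assms[of "s * b"] s \<open>b \<noteq> 0\<close> by (smt (verit) mult_pos_pos zero_less_power2)
qed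

lemma bilin_Cauchy_Schwarz:
  assumes sym: "\<And>i j. i \<in> V \<Longrightarrow> j \<in> V \<Longrightarrow> H i j = H j i"
    and psd: "\<And>x. bilin V H x x \<ge> 0"
  shows "(bilin V H x y)\<^sup>2 \<le> bilin V H x x * bilin V H y y"
proof (cases "bilin V H y y = 0")
  case True
  \<comment> \<open>A null vector \<open>y\<close> minimises a semidefinite form, hence is
    orthogonal to every \<open>x\<close>; the form need not be definite.\<close>
  have "- bilin V H x y = 0"
  proof (rule linear_coeff_zero_if_quadratic_nonpos[where c = "- bilin V H x x"])
    fix t
    have "bilin V H (\<lambda>i. y i + t * x i) (\<lambda>i. y i + t * x i) \<ge> 0"
      by (rule psd)
    then show "2 * t * - bilin V H x y + t\<^sup>2 * - bilin V H x x \<le> 0"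
      using True bilin_commute[of V H x y, OF sym]
      by (simp add: bilin_add_scaled_self[OF sym])
  qed
  then show ?thesis using True by simp
next
  case False
  define b where "b = bilin V H y y"
  have b: "b > 0" using False psd[of y] by (simp add: b_def)
  \<comment> \<open>The minimiser of the form along the line \<open>x + t * y\<close>.\<close>
  let ?t = "- bilin V H x y / b"
  have "0 \<le> bilin V H (\<lambda>i. x i + ?t * y i) (\<lambda>i. x i + ?t * y i)"
    by (rule psd)
  also have "\<dots> = bilin V H x x - (bilin V H x y)\<^sup>2 / b"
  proof -
    have "2 * ?t * bilin V H x y + ?t\<^sup>2 * b = - (bilin V H x y)\<^sup>2 / b"
      using b by (simp add: power2_eq_square field_simps)
    then show ?thesis
      using bilin_add_scaled_self[of V H x ?t y, OF sym] by (simp add: b_def)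
  qed
  finally show ?thesis
    using b by (simp add: b_def[symmetric] field_simps)
qed

text \<open>Gaussian elimination, one index at a time: positive definiteness makes each pivot
  positive and passes to the Schur complement.\<close>

lemma positive_definite_solvable:
  assumes "finite V"
    and "\<And>i j. i \<in> V \<Longrightarrow> j \<in> V \<Longrightarrow> M i j = M j i"
    and "\<And>x. \<exists>i\<in>V. x i \<noteq> 0 \<Longrightarrow> bilin V M x x > 0"
  shows "\<exists>z. \<forall>i\<in>V. (\<Sum>j\<in>V. M i j * z j) = y i"
  using assms
proof (induction V arbitrary: M y rule: finite_induct)
  case empty
  then show ?case by simp
next
  case (insert a F)
  note sym = insert.prems(1) and pd = insert.prems(2)
  have sa: "M i a = M a i" if "i \<in> F" for i
    using sym[of i a] that by simp
  have exp: "bilin (insert a F) M x x =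
      M a a * (x a)\<^sup>2 + 2 * x a * (\<Sum>j\<in>F. M a j * x j) + bilin F M x x" for x
    by (rule bilin_insert_self) (use insert.hyps sa in auto)
  have Maa: "M a a > 0"
  proof -
    have "(\<Sum>j\<in>F. M a j * (if j = a then 1 else 0)) = 0"
      using insert.hyps by (intro sum.neutral) auto
    moreover have "bilin F M (\<lambda>i. if i = a then 1 else 0) (\<lambda>i. if i = a then 1 else 0) = 0"
      using insert.hyps unfolding bilin_def by (intro sum.neutral ballI) auto
    ultimately show ?thesis
      using exp[of "\<lambda>i. if i = a then 1 else 0"] pd[of "\<lambda>i. if i = a then 1 else 0"] by simp
  qed
  \<comment> \<open>The Schur complement of the pivot \<open>M a a\<close>.\<close>
  define M' where "M' i j = M i j - M i a * M a j / M a a" for i j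
  have bM': "bilin F M' x x = bilin F M x x - (\<Sum>j\<in>F. M a j * x j)\<^sup>2 / M a a" for x
  proof -
    have "(\<Sum>j\<in>F. M a j * x j)\<^sup>2 / M a a
        = (\<Sum>i\<in>F. \<Sum>j\<in>F. M i a * M a j / M a a * x i * x j)"
      unfolding power2_eq_square sum_product sum_divide_distrib
      by (intro sum.cong refl) (simp add: sa)
    then show ?thesis
      by (simp add: bilin_def M'_def sum_subtractf algebra_simps)
  qed
  have "\<exists>z. \<forall>i\<in>F. (\<Sum>j\<in>F. M' i j * z j) = y i - M i a * y a / M a a"
  proof (rule insert.IH)
    show "M' i j = M' j i" if "i \<in> F" "j \<in> F" for i j
      using that sym[of i j] sym[of i a] sym[of j a] by (simp add: M'_def)
    show "bilin F M' x x > 0" if nz: "\<exists>i\<in>F. x i \<noteq> 0" for x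
    proof -
      define s where "s = (\<Sum>j\<in>F. M a j * x j)"
      \<comment> \<open>For fixed values on \<open>F\<close> this coordinate at \<open>a\<close>
        minimises the form of \<open>M\<close>, and the minimum is the form of \<open>M'\<close> at
        \<open>x\<close>.\<close>
      define x' where "x' = x(a := - s / M a a)"
      have eq: "\<And>i. i \<in> F \<Longrightarrow> x' i = x i" using insert.hyps by (auto simp: x'_def)
      have "bilin (insert a F) M x' x' > 0"
        using nz eq by (intro pd) auto
      moreover have "bilin F M x' x' = bilin F M x x"
        by (intro bilin_cong eq)
      moreover have "(\<Sum>j\<in>F. M a j * x' j) = s"
        unfolding s_def by (intro sum.cong refl) (simp add: eq)
      ultimately have "M a a * (- s / M a a)\<^sup>2 + 2 * (- s / M a a) * s + bilin F M x x > 0"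
        unfolding exp by (simp add: x'_def)
      moreover have "M a a * (- s / M a a)\<^sup>2 + 2 * (- s / M a a) * s = - (s\<^sup>2 / M a a)"
        using Maa by (simp add: power2_eq_square field_simps)
      ultimately show ?thesis unfolding bM' s_def[symmetric] by linarith
    qed
  qed
  then obtain z where z: "\<And>i. i \<in> F \<Longrightarrow> (\<Sum>j\<in>F. M' i j * z j) = y i - M i a * y a / M a a"
    by blast
  define s where "s = (\<Sum>j\<in>F. M a j * z j)"
  define z' where "z' = z(a := (y a - s) / M a a)"
  have eqs: "(\<Sum>j\<in>insert a F. M i j * z' j) = M i a * ((y a - s) / M a a) + (\<Sum>j\<in>F. M i j * z j)" for i
  proof -
    have "(\<Sum>j\<in>F. M i j * z' j) = (\<Sum>j\<in>F. M i j * z j)"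
      using insert.hyps by (intro sum.cong refl) (auto simp: z'_def)
    then show ?thesis using insert.hyps by (simp add: z'_def)
  qed
  have "(\<Sum>j\<in>insert a F. M i j * z' j) = y i" if "i \<in> insert a F" for i
  proof (cases "i = a")
    case True
    then show ?thesis using Maa unfolding eqs by (simp add: s_def)
  next
    case False
    then have "i \<in> F" using that by simp
    have "(\<Sum>j\<in>F. M' i j * z j) = (\<Sum>j\<in>F. M i j * z j) - M i a / M a a * s"
      unfolding s_def sum_distrib_left M'_def by (simp add: sum_subtractf algebra_simps)
    with z[OF \<open>i \<in> F\<close>] show ?thesis unfolding eqs using Maa
      by (simp add: field_simps)
  qed
  then show ?case by blast
qed

section \<open>Forms with exactly one positive direction\<close>

text \<open>Moving \<open>x\<close> along \<open>w\<close> into the hyperplane of \<open>l\<close>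
  only adds a nonnegative multiple of the value at \<open>w\<close>, since the cross term vanishes.
  So negativity on any one hyperplane carries over to the orthogonal complement of a positive
  vector.\<close>

lemma negative_definite_on_orthogonal:
  assumes sym: "\<And>i j. i \<in> V \<Longrightarrow> j \<in> V \<Longrightarrow> H i j = H j i"
    and neg: "\<And>x. (\<Sum>i\<in>V. l i * x i) = 0 \<Longrightarrow> \<exists>i\<in>V. x i \<noteq> 0 \<Longrightarrow> bilin V H x x < 0"
    and pos: "bilin V H w w > 0"
    and orth: "bilin V H x w = 0" and nz: "\<exists>i\<in>V. x i \<noteq> 0"
  shows "bilin V H x x < 0"
proof -
  define a where "a = (\<Sum>i\<in>V. l i * w i)"
  have wnz: "\<exists>i\<in>V. w i \<noteq> 0"
  proof (rule ccontr)
    assume "\<not> ?thesis"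
    then have "bilin V H w w = 0" unfolding bilin_def by (intro sum.neutral ballI) auto
    then show False using pos by simp
  qed
  have a: "a \<noteq> 0" using neg[OF _ wnz] pos a_def by fastforce
  define t where "t = - (\<Sum>i\<in>V. l i * x i) / a"
  define y where "y i = x i + t * w i" for i
  have ly: "(\<Sum>i\<in>V. l i * y i) = 0"
  proof -
    have "(\<Sum>i\<in>V. l i * y i) = (\<Sum>i\<in>V. l i * x i) + t * a"
      by (simp add: y_def a_def sum.distrib sum_distrib_left algebra_simps)
    then show ?thesis using a by (simp add: t_def)
  qed
  have yy: "bilin V H y y = bilin V H x x + t\<^sup>2 * bilin V H w w"
    unfolding y_def using bilin_add_scaled_self[of V H x t w, OF sym] by (simp add: orth)
  show ?thesis
  proof (cases "\<exists>i\<in>V. y i \<noteq> 0")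
    case True
    from neg[OF ly True] have "bilin V H x x + t\<^sup>2 * bilin V H w w < 0" by (simp add: yy)
    moreover have "t\<^sup>2 * bilin V H w w \<ge> 0" using pos by simp
    ultimately show ?thesis by linarith
  next
    case False
    \<comment> \<open>If the moved vector vanishes, \<open>x\<close> is a multiple of
      \<open>w\<close>; being orthogonal to \<open>w\<close>, it is then zero.\<close>
    have "bilin V H x w + t * bilin V H w w = bilin V H y w"
      unfolding y_def bilin_add_scaled_left ..
    also have "\<dots> = 0" unfolding bilin_def using False by (intro sum.neutral ballI) auto
    finally have "t = 0" using orth pos by simp
    then have False using False nz by (auto simp: y_def)
    then show ?thesis ..
  qed
qed

text \<open>A null vector in the complement of \<open>w\<close> maximises the form there. By the
  first-order condition it is orthogonal to the whole complement, and it is orthogonal to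
  \<open>w\<close> by assumption, hence to everything.\<close>

lemma isotropic_in_kernel:
  assumes "finite V"
    and sym: "\<And>i j. i \<in> V \<Longrightarrow> j \<in> V \<Longrightarrow> H i j = H j i"
    and nonpos: "\<And>x. bilin V H x w = 0 \<Longrightarrow> bilin V H x x \<le> 0"
    and pos: "bilin V H w w > 0"
    and orth: "bilin V H x w = 0" and iso: "bilin V H x x = 0" and "k \<in> V"
  shows "(\<Sum>j\<in>V. H k j * x j) = 0"
proof -
  define e where "e i = (if i = k then 1 else 0 :: real)" for i
  \<comment> \<open>The unit vector at \<open>k\<close>, projected along \<open>w\<close> into the
    complement of \<open>w\<close>.\<close>
  define y where "y i = e i + (- bilin V H e w / bilin V H w w) * w i" for i
  have yw: "bilin V H y w = 0"
    unfolding y_def bilin_add_scaled_left using pos by simp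
  have "bilin V H x y = 0"
  proof (rule linear_coeff_zero_if_quadratic_nonpos)
    fix t
    have "bilin V H (\<lambda>i. x i + t * y i) (\<lambda>i. x i + t * y i) \<le> 0"
      by (rule nonpos) (simp add: bilin_add_scaled_left orth yw)
    then show "2 * t * bilin V H x y + t\<^sup>2 * bilin V H y y \<le> 0"
      by (simp add: bilin_add_scaled_self[OF sym] iso)
  qed
  moreover have "bilin V H x y = bilin V H x e"
    unfolding y_def bilin_add_scaled_right orth by simp
  moreover have "bilin V H x e = (\<Sum>j\<in>V. H k j * x j)"
    unfolding e_def bilin_delta_right[OF \<open>finite V\<close> \<open>k \<in> V\<close>]
    by (intro sum.cong refl) (simp add: sym[OF _ \<open>k \<in> V\<close>])
  ultimately show ?thesis by simp
qed

text \<open>The diagonal is chosen so that \<open>w\<close> lies in the kernel of the difference; in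
  the coordinates \<open>x i / w i\<close> this difference is the Laplacian of a graph with edge
  weights \<open>H i j * w i * w j\<close>.\<close>

lemma weighted_square_minus_bilin:
  fixes V :: "'a set"
  assumes sym: "\<And>i j. i \<in> V \<Longrightarrow> j \<in> V \<Longrightarrow> H i j = H j i"
    and w: "\<And>i. i \<in> V \<Longrightarrow> w i > 0"
  shows "(\<Sum>i\<in>V. (\<Sum>j\<in>V. H i j * w j) / w i * (x i)\<^sup>2) - bilin V H x x =
    (\<Sum>i\<in>V. \<Sum>j\<in>V. H i j * w i * w j * (x i / w i - x j / w j)\<^sup>2) / 2"
proof -
  define A where "A = (\<Sum>i\<in>V. \<Sum>j\<in>V. H i j * w j / w i * (x i)\<^sup>2)"
  have A2: "A = (\<Sum>i\<in>V. \<Sum>j\<in>V. H i j * w i / w j * (x j)\<^sup>2)"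
    unfolding A_def by (subst sum.swap) (intro sum.cong refl, simp add: sym)
  have "(\<Sum>i\<in>V. \<Sum>j\<in>V. H i j * w i * w j * (x i / w i - x j / w j)\<^sup>2)
      = (\<Sum>i\<in>V. \<Sum>j\<in>V. H i j * w j / w i * (x i)\<^sup>2 + H i j * w i / w j * (x j)\<^sup>2
           - 2 * (H i j * x i * x j))"
  proof (intro sum.cong refl)
    fix i j assume "i \<in> V" "j \<in> V"
    then have "w i > 0" "w j > 0" using w by auto
    then show "H i j * w i * w j * (x i / w i - x j / w j)\<^sup>2 =
      H i j * w j / w i * (x i)\<^sup>2 + H i j * w i / w j * (x j)\<^sup>2 - 2 * (H i j * x i * x j)"
      by (simp add: power2_eq_square field_simps)
  qed
  also have "\<dots> = A + A - 2 * bilin V H x x"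
    unfolding sum.distrib sum_subtractf by (simp only: A_def[symmetric] A2[symmetric] bilin_def sum_distrib_left)
  also have "A = (\<Sum>i\<in>V. (\<Sum>j\<in>V. H i j * w j) / w i * (x i)\<^sup>2)"
    by (simp add: A_def sum_divide_distrib sum_distrib_right)
  finally show ?thesis
    by simp
qed

text \<open>The Bochner-type step: the inequalities for the forms \<open>K i\<close> sum up to
  \<open>x\<^sup>T H x \<le> (H x)\<^sup>T D\<^sup>-\<^sup>1 (H x)\<close> with \<open>D = diag (H w) / diag w\<close>, while \<open>H \<le> D\<close>
  with kernel spanned by \<open>w\<close> (Perron--Frobenius).  So no eigenvalue of \<open>D\<^sup>-\<^sup>1 H\<close> lies in the
  open interval from \<open>0\<close> to \<open>1\<close>, and \<open>1\<close> is a simple eigenvalue.\<close>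

lemma negative_definite_step:
  fixes V :: "'a set"
  assumes fin: "finite V" and o: "v \<in> V"
    and w: "\<And>i. i \<in> V \<Longrightarrow> w i > 0"
    and sym: "\<And>i j. i \<in> V \<Longrightarrow> j \<in> V \<Longrightarrow> H i j = H j i"
    and nonneg: "\<And>i j. i \<in> V \<Longrightarrow> j \<in> V \<Longrightarrow> H i j \<ge> 0"
    and posrow: "\<And>j. j \<in> V \<Longrightarrow> H v j > 0"
    and e: "e > 0"
    and Ksym: "\<And>i j k. i \<in> V \<Longrightarrow> j \<in> V \<Longrightarrow> k \<in> V \<Longrightarrow> K i j k = K i k j"
    and Ksum: "\<And>j k. j \<in> V \<Longrightarrow> k \<in> V \<Longrightarrow> (\<Sum>i\<in>V. w i * K i j k) = e * H j k"
    and Kw: "\<And>i j. i \<in> V \<Longrightarrow> j \<in> V \<Longrightarrow> (\<Sum>k\<in>V. K i j k * w k) = e * H i j"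
    and Kneg: "\<And>i x. i \<in> V \<Longrightarrow> bilin V (K i) x w = 0 \<Longrightarrow> bilin V (K i) x x \<le> 0"
    and Kneg0: "\<And>x. bilin V (K v) x w = 0 \<Longrightarrow> \<exists>i\<in>V. x i \<noteq> 0 \<Longrightarrow> bilin V (K v) x x < 0"
    and orth: "bilin V H x w = 0" and nz: "\<exists>i\<in>V. x i \<noteq> 0"
  shows "bilin V H x x < 0"
proof -
  define Hv where "Hv x i = (\<Sum>j\<in>V. H i j * x j)" for x i
  define h where "h = Hv w"
  define D where "D i = h i / w i" for i
  have bilin_H: "bilin V H x y = (\<Sum>i\<in>V. x i * Hv y i)" for x y
    unfolding bilin_rows Hv_def ..
  have bilin_Hw: "bilin V H x w = (\<Sum>i\<in>V. h i * x i)" for x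
    unfolding bilin_H h_def by (simp add: mult.commute)
  have h: "h i > 0" if "i \<in> V" for i
  proof -
    have "0 < H i v * w v" using posrow[OF that] sym[OF that o] w[OF o] by simp
    also have "\<dots> \<le> (\<Sum>j\<in>V. H i j * w j)"
      by (rule member_le_sum) (use o fin nonneg w that in \<open>auto intro!: mult_nonneg_nonneg intro: less_imp_le\<close>)
    finally show ?thesis by (simp add: h_def Hv_def)
  qed
  have D: "D i > 0" if "i \<in> V" for i using h w that by (simp add: D_def)
  have Dw: "D i * w i = h i" if "i \<in> V" for i using w[OF that] by (simp add: D_def)
  have hw: "(\<Sum>i\<in>V. h i * w i) > 0"
    using o fin h w by (intro sum_pos) auto
  have ww: "bilin V H w w > 0" using hw by (simp add: bilin_Hw)
  have Kbw: "bilin V (K i) y w = e * Hv y i" if "i \<in> V" for y i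
  proof -
    have "bilin V (K i) y w = (\<Sum>j\<in>V. y j * (e * H i j))"
      unfolding bilin_rows by (intro sum.cong refl) (simp add: Kw that)
    then show ?thesis by (simp add: Hv_def sum_distrib_left mult_ac)
  qed
  \<comment> \<open>The reversed Cauchy-Schwarz inequality for \<open>K i\<close>: \<open>y\<close>
    is moved along \<open>w\<close> into the complement of \<open>w\<close>, and Euler's identity
    evaluates \<open>K i\<close> at \<open>(y, w)\<close> and \<open>(w, w)\<close> as
    \<open>e * Hv y i\<close> and \<open>e * h i\<close>.\<close>
  have Kxx: "bilin V (K i) y y \<le> e * ((Hv y i)\<^sup>2 / h i)" if i: "i \<in> V" for y i
  proof -
    define t where "t = - Hv y i / h i"
    have "bilin V (K i) (\<lambda>j. y j + t * w j) w = 0"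
      unfolding bilin_add_scaled_left Kbw[OF i] h_def[symmetric] using h[OF i]
      by (simp add: t_def)
    from Kneg[OF i this]
    have "bilin V (K i) y y + 2 * t * bilin V (K i) y w + t\<^sup>2 * bilin V (K i) w w \<le> 0"
      using bilin_add_scaled_self[of V "K i" y t w, OF Ksym[OF i]] by simp
    moreover have "2 * t * bilin V (K i) y w + t\<^sup>2 * bilin V (K i) w w = - (e * ((Hv y i)\<^sup>2 / h i))"
      unfolding Kbw[OF i] h_def[symmetric] using h[OF i]
      by (simp add: t_def power2_eq_square field_simps)
    ultimately show ?thesis by linarith
  qed
  have Ksum_bilin: "(\<Sum>i\<in>V. w i * bilin V (K i) y y) = e * bilin V H y y" for y
  proof -
    have "(\<Sum>i\<in>V. w i * bilin V (K i) y y) = (\<Sum>i\<in>V. \<Sum>j\<in>V. \<Sum>k\<in>V. w i * K i j k * y j * y k)"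
      by (simp add: bilin_def sum_distrib_left mult_ac)
    also have "\<dots> = (\<Sum>j\<in>V. \<Sum>i\<in>V. \<Sum>k\<in>V. w i * K i j k * y j * y k)"
      by (rule sum.swap)
    also have "\<dots> = (\<Sum>j\<in>V. \<Sum>k\<in>V. \<Sum>i\<in>V. w i * K i j k * y j * y k)"
      by (intro sum.cong refl sum.swap)
    also have "\<dots> = (\<Sum>j\<in>V. \<Sum>k\<in>V. e * H j k * y j * y k)"
      by (intro sum.cong refl) (simp add: Ksum[symmetric] sum_distrib_right)
    finally show ?thesis by (simp add: bilin_def sum_distrib_left mult_ac)
  qed
  have Hle: "bilin V H y y \<le> (\<Sum>i\<in>V. (Hv y i)\<^sup>2 / D i)" for y
  proof -
    have "e * bilin V H y y \<le> (\<Sum>i\<in>V. w i * (e * ((Hv y i)\<^sup>2 / h i)))"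
      unfolding Ksum_bilin[symmetric]
      by (intro sum_mono mult_left_mono Kxx less_imp_le w)
    also have "\<dots> = e * (\<Sum>i\<in>V. (Hv y i)\<^sup>2 / D i)"
      by (simp add: sum_distrib_left D_def mult_ac)
    finally show ?thesis using e by simp
  qed
  \<comment> \<open>\<open>B = D - H\<close> is the Laplacian of the preceding identity: positive
    semidefinite, with \<open>w\<close> in its kernel.\<close>
  define B where "B i j = (if i = j then D i else 0) - H i j" for i j
  have Bsym: "B i j = B j i" if "i \<in> V" "j \<in> V" for i j
    using sym[OF that] by (simp add: B_def)
  have Brow: "(\<Sum>j\<in>V. B i j * y j) = D i * y i - Hv y i" if "i \<in> V" for y i
  proof -
    have "(\<Sum>j\<in>V. (if i = j then D i else 0) * y j) = D i * y i"
      using that fin by (simp add: if_distrib[of "\<lambda>a. a * _"] cong: if_cong)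
    then show ?thesis by (simp add: B_def Hv_def left_diff_distrib sum_subtractf)
  qed
  have Bbilin: "bilin V B y z = (\<Sum>i\<in>V. D i * y i * z i) - bilin V H y z" for y z
  proof -
    have "bilin V B y z = (\<Sum>i\<in>V. y i * (D i * z i - Hv z i))"
      unfolding bilin_rows by (intro sum.cong refl) (simp add: Brow)
    then show ?thesis by (simp add: bilin_H right_diff_distrib sum_subtractf mult_ac)
  qed
  have Bsq: "bilin V B y y =
    (\<Sum>i\<in>V. \<Sum>j\<in>V. H i j * w i * w j * (y i / w i - y j / w j)\<^sup>2) / 2" for y
    using weighted_square_minus_bilin[of V H w y, OF sym w]
    unfolding Bbilin by (simp add: D_def h_def Hv_def power2_eq_square mult_ac)
  have term_nonneg: "H i j * w i * w j * (y i / w i - y j / w j)\<^sup>2 \<ge> 0" if "i \<in> V" "j \<in> V" for y i j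
    using nonneg[OF that] w that by (intro mult_nonneg_nonneg) (auto intro: less_imp_le)
  have Bpsd: "bilin V B y y \<ge> 0" for y
    unfolding Bsq using term_nonneg by (simp add: sum_nonneg)
  \<comment> \<open>All edges at \<open>v\<close> have positive weight, so a vanishing Laplacian
    makes \<open>y i / w i\<close> constant.\<close>
  have Bker: "y i = (y v / w v) * w i" if "bilin V B y y = 0" "i \<in> V" for y i
  proof -
    have "(\<Sum>i\<in>V. \<Sum>j\<in>V. H i j * w i * w j * (y i / w i - y j / w j)\<^sup>2) = 0"
      using that(1) unfolding Bsq by simp
    then have "\<forall>i\<in>V. (\<Sum>j\<in>V. H i j * w i * w j * (y i / w i - y j / w j)\<^sup>2) = 0"
      by (subst (asm) sum_nonneg_eq_0_iff) (use fin term_nonneg in \<open>auto intro!: sum_nonneg\<close>)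
    then have "(\<Sum>j\<in>V. H v j * w v * w j * (y v / w v - y j / w j)\<^sup>2) = 0" using o by blast
    then have "\<forall>j\<in>V. H v j * w v * w j * (y v / w v - y j / w j)\<^sup>2 = 0"
      by (subst (asm) sum_nonneg_eq_0_iff) (use fin o term_nonneg in auto)
    then have "H v i * w v * w i * (y v / w v - y i / w i)\<^sup>2 = 0" using that(2) by blast
    moreover have "H v i > 0" "w v > 0" "w i > 0" using posrow w o that(2) by auto
    ultimately have "y v / w v = y i / w i" by simp
    then show ?thesis using \<open>w i > 0\<close> by simp
  qed
  \<comment> \<open>\<open>B\<close> is singular exactly along \<open>w\<close>; since the sum of
    \<open>h i * w i\<close> is positive, adding the square of the functional \<open>h\<close> makes
    it positive definite.\<close>
  define M where "M i j = B i j + h i * h j" for i j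
  have Mrow: "(\<Sum>j\<in>V. M i j * y j) = (\<Sum>j\<in>V. B i j * y j) + h i * (\<Sum>j\<in>V. h j * y j)" for i y
    by (simp add: M_def distrib_right sum.distrib sum_distrib_left mult.assoc)
  have Mbilin: "bilin V M y z = bilin V B y z + (\<Sum>i\<in>V. h i * y i) * (\<Sum>i\<in>V. h i * z i)" for y z
    unfolding bilin_rows Mrow by (simp add: distrib_left sum.distrib sum_distrib_right mult_ac)
  \<comment> \<open>The spectral gap in dual form. Let \<open>z\<close> solve
    \<open>B z = D x\<close>, and let \<open>X\<close>, \<open>Y\<close> pair \<open>D x\<close>
    with \<open>z\<close> and with \<open>x\<close>. Then \<open>B\<close> has values
    \<open>X\<close> at \<open>(z, z)\<close> and \<open>Y\<close> at \<open>(x, z)\<close>.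
    Inequality \<open>Hle\<close> at \<open>z\<close> says \<open>X \<le> Y\<close>, and
    Cauchy-Schwarz for \<open>B\<close> turns this into
    \<open>Y \<le> bilin V B x x = Y - bilin V H x x\<close>.\<close>
  have semi: "bilin V H x x \<le> 0"
    if orth: "bilin V H x w = 0" and nz: "\<exists>i\<in>V. x i \<noteq> 0" for x
  proof -
    have "\<exists>z. \<forall>i\<in>V. (\<Sum>j\<in>V. M i j * z j) = D i * x i"
    proof (rule positive_definite_solvable[OF fin])
      show "M i j = M j i" if "i \<in> V" "j \<in> V" for i j
        using Bsym[OF that] by (simp add: M_def)
      show "bilin V M y y > 0" if nzy: "\<exists>i\<in>V. y i \<noteq> 0" for y
      proof (rule ccontr)
        assume "\<not> ?thesis"
        then have "bilin V B y y + (\<Sum>i\<in>V. h i * y i)\<^sup>2 \<le> 0"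
          by (simp add: Mbilin power2_eq_square)
        moreover have "(\<Sum>i\<in>V. h i * y i)\<^sup>2 \<ge> 0" by simp
        ultimately have B0: "bilin V B y y = 0" and "(\<Sum>i\<in>V. h i * y i)\<^sup>2 = 0"
          using Bpsd[of y] by linarith+
        then have hy: "(\<Sum>i\<in>V. h i * y i) = 0" by simp
        define t where "t = y v / w v"
        have y: "y i = t * w i" if "i \<in> V" for i using Bker[OF B0 that] by (simp add: t_def)
        have "(\<Sum>i\<in>V. h i * y i) = t * (\<Sum>i\<in>V. h i * w i)"
          unfolding sum_distrib_left by (intro sum.cong refl) (simp add: y)
        then have "t = 0" using hy hw by simp
        then show False using nzy y by auto
      qed
    qed
    then obtain z where z: "\<And>i. i \<in> V \<Longrightarrow> (\<Sum>j\<in>V. M i j * z j) = D i * x i" by blast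
    have hx: "(\<Sum>i\<in>V. h i * x i) = 0" using orth by (simp add: bilin_Hw)
    have "bilin V M w z = (\<Sum>i\<in>V. w i * (D i * x i))"
      unfolding bilin_rows by (intro sum.cong refl) (simp add: z)
    also have "\<dots> = (\<Sum>i\<in>V. h i * x i)"
      by (intro sum.cong refl) (simp add: Dw[symmetric])
    finally have Mwz: "bilin V M w z = 0" using hx by simp
    \<comment> \<open>Pairing \<open>M z = D x\<close> with \<open>w\<close> kills
      \<open>B z\<close>, and also \<open>D x\<close> because \<open>x\<close> is orthogonal to
      \<open>w\<close>; so \<open>h\<close> annihilates \<open>z\<close> and the added rank-one term
      drops out.\<close>
    have "bilin V B w z = bilin V B z w" by (rule bilin_commute) (rule Bsym)
    also have "\<dots> = 0"
      unfolding bilin_rows using Dw by (intro sum.neutral ballI) (simp add: Brow h_def[symmetric])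
    finally have hz: "(\<Sum>i\<in>V. h i * z i) = 0" using Mwz hw by (simp add: Mbilin)
    have Hz: "Hv z i = D i * (z i - x i)" if "i \<in> V" for i
      using z[OF that] Brow[OF that, of z] by (simp add: Mrow hz right_diff_distrib)
    define X where "X = (\<Sum>i\<in>V. D i * x i * z i)"
    define Y where "Y = (\<Sum>i\<in>V. D i * (x i)\<^sup>2)"
    have Bz: "bilin V B y z = (\<Sum>i\<in>V. D i * x i * y i)" for y
      unfolding bilin_rows
      by (intro sum.cong refl) (simp add: Brow Hz right_diff_distrib)
    have XY: "X \<le> Y"
    proof -
      have "(\<Sum>i\<in>V. z i * Hv z i) \<le> (\<Sum>i\<in>V. (Hv z i)\<^sup>2 / D i)"
        using Hle[of z] by (simp add: bilin_H)
      moreover have "(\<Sum>i\<in>V. z i * Hv z i) - (\<Sum>i\<in>V. (Hv z i)\<^sup>2 / D i) = (\<Sum>i\<in>V. D i * x i * z i - D i * (x i)\<^sup>2)"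
        unfolding sum_subtractf[symmetric]
      proof (intro sum.cong refl)
        fix i assume i: "i \<in> V"
        show "z i * Hv z i - (Hv z i)\<^sup>2 / D i = D i * x i * z i - D i * (x i)\<^sup>2"
          using D[OF i] by (simp add: Hz[OF i] power2_eq_square field_simps)
      qed
      ultimately show ?thesis by (simp add: X_def Y_def sum_subtractf)
    qed
    have Ypos: "Y > 0"
    proof -
      obtain i where i: "i \<in> V" "x i \<noteq> 0" using nz by blast
      have "0 < D i * (x i)\<^sup>2" using D i by simp
      also have "\<dots> \<le> Y" unfolding Y_def
        by (rule member_le_sum) (use i fin D in \<open>auto intro!: mult_nonneg_nonneg intro: less_imp_le\<close>)
      finally show ?thesis .
    qed
    have "Y\<^sup>2 \<le> bilin V B x x * X"
      using bilin_Cauchy_Schwarz[of V B x z, OF Bsym Bpsd] unfolding Bz X_def Y_def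
      by (simp add: power2_eq_square mult_ac)
    also have "\<dots> \<le> bilin V B x x * Y" by (intro mult_left_mono XY Bpsd)
    finally have "Y \<le> bilin V B x x" using Ypos by (simp add: power2_eq_square)
    also have "bilin V B x x = Y - bilin V H x x"
      by (simp add: Bbilin Y_def power2_eq_square mult_ac)
    finally show ?thesis by simp
  qed
  have semi': "bilin V H x x \<le> 0" if "bilin V H x w = 0" for x
  proof (cases "\<exists>i\<in>V. x i \<noteq> 0")
    case True
    with that show ?thesis by (rule semi)
  next
    case False
    then have "bilin V H x x = 0" unfolding bilin_def by (intro sum.neutral ballI) auto
    then show ?thesis by simp
  qed
  show ?thesis
  proof (rule ccontr)
    assume "\<not> ?thesis"
    then have iso: "bilin V H x x = 0" using semi'[OF orth] by simp
    \<comment> \<open>Equality forces \<open>H x = 0\<close>, so by Euler's identity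
      \<open>x\<close> is orthogonal to \<open>w\<close> for every \<open>K i\<close>. The strict
      inequality for \<open>K v\<close> then contradicts the weighted sum of the \<open>K i\<close>
      being \<open>e\<close> times \<open>H\<close>.\<close>
    have "Hv x i = 0" if "i \<in> V" for i
      unfolding Hv_def
      by (rule isotropic_in_kernel[OF fin sym semi' ww orth iso that])
    then have K0: "bilin V (K i) x w = 0" if "i \<in> V" for i
      using that by (simp add: Kbw)
    have "(\<Sum>i\<in>V. w i * bilin V (K i) x x) < 0"
    proof (rule sum_strict_mono_ex1[of V _ "\<lambda>_. 0", simplified])
      show "finite V" by (rule fin)
      show "\<forall>i\<in>V. w i * bilin V (K i) x x \<le> 0"
        using Kneg K0 w by (simp add: mult_le_0_iff less_imp_le)
      show "\<exists>i\<in>V. w i * bilin V (K i) x x < 0"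
        using Kneg0[OF K0[OF o] nz] w[OF o] o by (intro bexI[of _ v]) (simp add: mult_less_0_iff)
    qed
    then show False unfolding Ksum_bilin iso by simp
  qed
qed

section \<open>The quadratic case\<close>

text \<open>The double sum is the sum over the classes of the squared class sums, so this is
  Cauchy-Schwarz over the classes, of which there are at most \<open>card S\<close>.\<close>

lemma square_sum_le_card_times_block_sum:
  fixes y :: "'a \<Rightarrow> real"
  assumes fin: "finite S" and R: "equiv S R"
  shows "(\<Sum>i\<in>S. y i)\<^sup>2 \<le> real (card S) * (\<Sum>i\<in>S. \<Sum>j\<in>S. if (i, j) \<in> R then y i * y j else 0)"
proof -
  define Q where "Q = S // R"
  have finQ: "finite Q" unfolding Q_def
    by (rule finite_quotient) (use fin R in \<open>auto simp: equiv_def refl_on_def\<close>)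
  have UQ: "\<Union> Q = S" unfolding Q_def by (rule Union_quotient[OF R])
  have finP: "\<forall>P\<in>Q. finite P" using UQ fin by (meson Union_upper rev_finite_subset)
  have disj: "\<forall>P\<in>Q. \<forall>P'\<in>Q. P \<noteq> P' \<longrightarrow> P \<inter> P' = {}"
    using quotient_disj[OF R] unfolding Q_def by blast
  have split: "(\<Sum>i\<in>S. f i) = (\<Sum>P\<in>Q. \<Sum>i\<in>P. f i)" for f :: "'a \<Rightarrow> real"
    using sum.Union_disjoint[OF finP disj, of f] by (simp add: UQ comp_def)
  have cardQ: "card Q \<le> card S"
  proof -
    have "Q = (\<lambda>i. R `` {i}) ` S" unfolding Q_def quotient_def by blast
    then show ?thesis using card_image_le[OF fin] by simp
  qed
  have block: "(\<Sum>j\<in>S. if (i, j) \<in> R then y i * y j else 0) = y i * (\<Sum>j\<in>P. y j)"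
    if P: "P \<in> Q" and i: "i \<in> P" for P i
  proof -
    obtain a where a: "P = R `` {a}" "a \<in> S"
      using P unfolding Q_def by (elim quotientE)
    then have "P = R `` {i}"
      using i equiv_class_eq[OF R] by auto
    then have "P = {j \<in> S. (i, j) \<in> R}"
      using R unfolding equiv_def refl_on_def by auto
    then show ?thesis
      using fin by (simp add: sum_distrib_left sum.inter_filter[symmetric])
  qed
  have "(\<Sum>i\<in>S. y i)\<^sup>2 = (\<Sum>P\<in>Q. \<Sum>i\<in>P. y i)\<^sup>2" by (simp add: split)
  also have "\<dots> \<le> real (card Q) * (\<Sum>P\<in>Q. (\<Sum>i\<in>P. y i)\<^sup>2)"
    using sum_squared_le_sum_of_squares[of "\<lambda>P. \<Sum>i\<in>P. y i" Q] by (simp add: mult.commute)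
  also have "\<dots> \<le> real (card S) * (\<Sum>P\<in>Q. (\<Sum>i\<in>P. y i)\<^sup>2)"
    using cardQ by (intro mult_right_mono) (auto intro: sum_nonneg)
  also have "(\<Sum>P\<in>Q. (\<Sum>i\<in>P. y i)\<^sup>2) =
      (\<Sum>i\<in>S. \<Sum>j\<in>S. if (i, j) \<in> R then y i * y j else 0)"
    unfolding split[of "\<lambda>i. \<Sum>j\<in>S. if (i, j) \<in> R then y i * y j else 0"]
    by (intro sum.cong refl) (simp add: block power2_eq_square sum_distrib_right cong: sum.cong)
  finally show ?thesis .
qed

text \<open>The condition \<open>plane\<close> says that \<open>(x0, y)\<close> is orthogonal to the
  direction of \<open>x0\<close>, so eliminating \<open>x0\<close> completes the square and leaves
  \<open>- c1^2 * s^2 / c0\<close>. The rest is at most \<open>c2 * (1 - 1/N) * s^2\<close>, which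
  \<open>lc\<close> compares with it.\<close>

lemma negative_quadratic_form_of_parallel_classes:
  fixes y :: "'a \<Rightarrow> real"
  assumes fin: "finite S" and R: "equiv S R" and q: "0 < q" "q \<le> 1"
    and c: "c0 > 0" "c1 > 0" "c2 > 0"
    and lc: "c1\<^sup>2 * real (card S) > c0 * c2 * (real (card S) - 1)"
    and plane: "c0 * x0 + c1 * (\<Sum>i\<in>S. y i) = 0"
    and nz: "x0 \<noteq> 0 \<or> (\<exists>i\<in>S. y i \<noteq> 0)"
  shows "c0 * x0\<^sup>2 + 2 * c1 * x0 * (\<Sum>i\<in>S. y i) +
    c2 * (\<Sum>i\<in>S. \<Sum>j\<in>S. (if i = j then 0 else if (i, j) \<in> R then q else 1) * (y i * y j)) < 0"
proof -
  define s where "s = (\<Sum>i\<in>S. y i)"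
  define N where "N = real (card S)"
  define b where "b = (\<Sum>i\<in>S. \<Sum>j\<in>S. if (i, j) \<in> R then y i * y j else 0)"
  define p where "p = (\<Sum>i\<in>S. (y i)\<^sup>2)"
  have ynz: "\<exists>i\<in>S. y i \<noteq> 0"
  proof (rule ccontr)
    assume neg: "\<not> ?thesis"
    then have "x0 = 0" using plane c by simp
    then show False using nz neg by simp
  qed
  have ppos: "p > 0"
  proof -
    obtain i where i: "i \<in> S" "y i \<noteq> 0" using ynz by blast
    then have "0 < (y i)\<^sup>2" by simp
    also have "\<dots> \<le> p" unfolding p_def by (rule member_le_sum) (use i fin in auto)
    finally show ?thesis .
  qed
  have Npos: "N > 0" using ynz fin by (auto simp: N_def card_gt_0_iff)
  have sb: "s\<^sup>2 \<le> N * b"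
    unfolding s_def N_def b_def by (rule square_sum_le_card_times_block_sum[OF fin R])
  have sp: "s\<^sup>2 \<le> N * p"
    using sum_squared_le_sum_of_squares[of y S] by (simp add: s_def N_def p_def mult.commute)
  have refl: "(i, i) \<in> R" if "i \<in> S" for i using R that by (auto simp: equiv_def refl_on_def)
  \<comment> \<open>The coefficient matrix is the all-ones matrix minus \<open>1 - q\<close> times
    the block matrix of \<open>R\<close> minus \<open>q\<close> times the identity.\<close>
  have offdiag: "(\<Sum>i\<in>S. \<Sum>j\<in>S. (if i = j then 0 else if (i, j) \<in> R then q else 1) * (y i * y j))
      = s\<^sup>2 - (1 - q) * b - q * p"
  proof -
    have "(\<Sum>i\<in>S. \<Sum>j\<in>S. (if i = j then 0 else if (i, j) \<in> R then q else 1) * (y i * y j)) =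
      (\<Sum>i\<in>S. \<Sum>j\<in>S. y i * y j - (1 - q) * (if (i, j) \<in> R then y i * y j else 0)
         - (if i = j then q * (y j)\<^sup>2 else 0))"
      by (intro sum.cong HOL.refl) (auto simp: refl power2_eq_square algebra_simps)
    also have "\<dots> = s\<^sup>2 - (1 - q) * b - q * p"
      using fin by (simp add: sum_subtractf s_def b_def p_def power2_eq_square sum_product
          flip: sum_distrib_left)
    finally show ?thesis .
  qed
  \<comment> \<open>A convex combination of two Cauchy-Schwarz bounds, one over the classes and one
    over single elements; this is where \<open>q \<le> 1\<close> enters.\<close>
  have "N * ((1 - q) * b + q * p) \<ge> s\<^sup>2"
  proof -
    have "N * ((1 - q) * b + q * p) = (1 - q) * (N * b) + q * (N * p)" by (simp add: algebra_simps)
    also have "\<dots> \<ge> (1 - q) * s\<^sup>2 + q * s\<^sup>2"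
      using sb sp q by (intro add_mono mult_left_mono) auto
    finally show ?thesis by (simp add: algebra_simps)
  qed
  then have defect: "(1 - q) * b + q * p \<ge> s\<^sup>2 / N" using Npos by (simp add: field_simps)
  have x0: "x0 = - c1 * s / c0" using plane c by (simp add: s_def field_simps)
  have sq: "c0 * x0\<^sup>2 + 2 * c1 * x0 * s = - (c1\<^sup>2 * s\<^sup>2 / c0)"
    unfolding x0 using c by (simp add: power2_eq_square field_simps)
  have "c2 * (s\<^sup>2 - (1 - q) * b - q * p) < c1\<^sup>2 * s\<^sup>2 / c0"
  \<comment> \<open>For \<open>s = 0\<close> both sides of the comparison through \<open>lc\<close>
    vanish, and strictness comes from \<open>q * p > 0\<close> instead.\<close>
  proof (cases "s = 0")
    case True
    then have "b \<ge> 0" using sb Npos by (simp add: zero_le_mult_iff)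
    then have "(1 - q) * b + q * p > 0" using q ppos by (simp add: add_nonneg_pos)
    then have "c2 * ((1 - q) * b + q * p) > 0" using c by simp
    then show ?thesis using True by (simp add: algebra_simps)
  next
    case False
    have "c2 * (s\<^sup>2 - (1 - q) * b - q * p) \<le> c2 * (s\<^sup>2 - s\<^sup>2 / N)"
      using defect c by (intro mult_left_mono) auto
    also have "\<dots> = c0 * c2 * (N - 1) * (s\<^sup>2 / (c0 * N))"
      using Npos c by (simp add: field_simps)
    also have "\<dots> < c1\<^sup>2 * N * (s\<^sup>2 / (c0 * N))"
      using lc False c Npos unfolding N_def[symmetric] by (intro mult_strict_right_mono) auto
    also have "\<dots> = c1\<^sup>2 * s\<^sup>2 / c0" using Npos c by simp
    finally show ?thesis .
  qed
  then show ?thesis unfolding offdiag s_def[symmetric] sq by linarith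
qed

section \<open>Matroid rank functions\<close>

lemma matroid_rank_obtain:
  assumes M: "matroid E \<I>" and A: "A \<subseteq> E"
  obtains X where "X \<in> \<I>" "X \<subseteq> A" "card X = matroid_rank \<I> A"
proof -
  have "finite {X \<in> \<I>. X \<subseteq> A}"
    using M A unfolding matroid_def by (auto intro: finite_subset[of _ "Pow E"])
  moreover have "{} \<in> {X \<in> \<I>. X \<subseteq> A}" using M by (simp add: matroid_def)
  ultimately have "matroid_rank \<I> A \<in> card ` {X \<in> \<I>. X \<subseteq> A}"
    unfolding matroid_rank_def by (intro Max_in) auto
  then show ?thesis using that by auto
qed

lemma card_le_matroid_rank:
  assumes M: "matroid E \<I>" and "X \<in> \<I>" "X \<subseteq> A"
  shows "card X \<le> matroid_rank \<I> A"
proof -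
  have "finite {X \<in> \<I>. X \<subseteq> A}"
    using M unfolding matroid_def by (auto intro: finite_subset[of _ "Pow E"])
  then show ?thesis unfolding matroid_rank_def using assms by (intro Max_ge) auto
qed

lemma matroid_rank_mono:
  assumes M: "matroid E \<I>" and "A \<subseteq> B" "B \<subseteq> E"
  shows "matroid_rank \<I> A \<le> matroid_rank \<I> B"
proof -
  obtain X where "X \<in> \<I>" "X \<subseteq> A" "card X = matroid_rank \<I> A"
    using matroid_rank_obtain[OF M] assms by (metis order_trans)
  then show ?thesis using card_le_matroid_rank[OF M, of X B] assms by auto
qed

lemma matroid_rank_insert_le:
  assumes M: "matroid E \<I>" and "insert i A \<subseteq> E"
  shows "matroid_rank \<I> (insert i A) \<le> Suc (matroid_rank \<I> A)"
proof -
  obtain X where X: "X \<in> \<I>" "X \<subseteq> insert i A" "card X = matroid_rank \<I> (insert i A)"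
    using matroid_rank_obtain[OF M assms(2)] .
  have "X - {i} \<in> \<I>" using M X(1) unfolding matroid_def by blast
  then have "card (X - {i}) \<le> matroid_rank \<I> A"
    using X by (intro card_le_matroid_rank[OF M]) auto
  moreover have "card X \<le> Suc (card (X - {i}))"
    unfolding card_Diff_singleton_if by (simp split: if_split) arith
  ultimately show ?thesis using X by simp
qed

lemma matroid_augment:
  assumes M: "matroid E \<I>" and "Y \<subseteq> E" "X \<in> \<I>" "X \<subseteq> Y"
  obtains J where "J \<in> \<I>" "X \<subseteq> J" "J \<subseteq> Y" "card J = matroid_rank \<I> Y"
proof -
  have "\<exists>J. J \<in> \<I> \<and> X \<subseteq> J \<and> J \<subseteq> Y \<and> card J = matroid_rank \<I> Y"
    using assms(3,4)
  proof (induction "matroid_rank \<I> Y - card X" arbitrary: X)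
    case 0
    then show ?case using card_le_matroid_rank[OF M 0(2,3)] by auto
  next
    case (Suc k)
    obtain K where K: "K \<in> \<I>" "K \<subseteq> Y" "card K = matroid_rank \<I> Y"
      using matroid_rank_obtain[OF M assms(2)] .
    then have "card X < card K" using Suc.hyps(2) by linarith
    then obtain y where y: "y \<in> K - X" "insert y X \<in> \<I>"
      using M Suc.prems K unfolding matroid_def by blast
    have "finite X" using M Suc.prems unfolding matroid_def by (meson PowD finite_subset subsetD)
    then have "card (insert y X) = Suc (card X)" using y by simp
    then have "k = matroid_rank \<I> Y - card (insert y X)" using Suc.hyps(2) by linarith
    from Suc.hyps(1)[OF this y(2)] show ?case using y K Suc.prems by blast
  qed
  then show ?thesis using that by blast
qed

text \<open>Monotonicity of the closure. If \<open>i\<close> raised the rank of \<open>B\<close>, a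
  basis of \<open>B\<close> extending a basis \<open>I\<close> of \<open>A\<close> could be
  augmented only by \<open>i\<close>, and \<open>insert i I\<close> would already be independent in
  \<open>insert i A\<close>.\<close>

lemma matroid_rank_insert_eq_superset:
  assumes M: "matroid E \<I>" and "A \<subseteq> B" "insert i B \<subseteq> E"
    and eq: "matroid_rank \<I> (insert i A) = matroid_rank \<I> A"
  shows "matroid_rank \<I> (insert i B) = matroid_rank \<I> B"
proof (rule ccontr)
  assume neq: "\<not> ?thesis"
  have "matroid_rank \<I> B \<le> matroid_rank \<I> (insert i B)"
    by (rule matroid_rank_mono[OF M]) (use assms in auto)
  with neq have less: "matroid_rank \<I> B < matroid_rank \<I> (insert i B)" by simp
  obtain I where I: "I \<in> \<I>" "I \<subseteq> A" "card I = matroid_rank \<I> A"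
    using matroid_rank_obtain[OF M, of A] assms by blast
  obtain J where J: "J \<in> \<I>" "I \<subseteq> J" "J \<subseteq> B" "card J = matroid_rank \<I> B"
    using matroid_augment[OF M, of B I] assms I by blast
  obtain K where K: "K \<in> \<I>" "K \<subseteq> insert i B" "card K = matroid_rank \<I> (insert i B)"
    using matroid_rank_obtain[OF M assms(3)] .
  obtain y where y: "y \<in> K - J" "insert y J \<in> \<I>"
    using M J K less unfolding matroid_def by metis
  have fin: "finite Z" if "Z \<in> \<I>" for Z
    using M that unfolding matroid_def by (meson PowD finite_subset subsetD)
  have "y \<notin> B"
  proof
    assume "y \<in> B"
    then have "card (insert y J) \<le> matroid_rank \<I> B"
      using J y by (intro card_le_matroid_rank[OF M]) auto
    then show False using y J fin[of J] by simp
  qed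
  then have "y = i" "i \<notin> B" using y K by auto
  have "insert i I \<subseteq> insert y J" using J \<open>y = i\<close> by auto
  then have "insert i I \<in> \<I>" using M y(2) unfolding matroid_def by blast
  then have "card (insert i I) \<le> matroid_rank \<I> (insert i A)"
    using I by (intro card_le_matroid_rank[OF M]) auto
  moreover have "card (insert i I) = Suc (card I)"
    using fin[OF I(1)] \<open>i \<notin> B\<close> I assms by (subst card_insert_disjoint) auto
  ultimately show False using I eq by simp
qed

text \<open>Parallelism in the contraction by \<open>T\<close>; every loop forms a class of its own.\<close>

definition parallel_rel :: "'a set set \<Rightarrow> 'a set \<Rightarrow> 'a set \<Rightarrow> ('a \<times> 'a) set" where
  "parallel_rel \<I> T S = {(i, j). i \<in> S \<and> j \<in> S \<and>
     (i = j \<or> (matroid_rank \<I> (insert i T) = Suc (matroid_rank \<I> T) \<and>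
        matroid_rank \<I> (insert j T) = Suc (matroid_rank \<I> T) \<and>
        matroid_rank \<I> (insert i (insert j T)) = Suc (matroid_rank \<I> T)))}"

text \<open>For transitivity, \<open>i\<close> lies in the closure of \<open>insert j T\<close>,
  hence in that of \<open>T\<close> with \<open>j\<close> and \<open>k\<close>, whose rank is one
  above that of \<open>T\<close>; this bounds the rank of \<open>T\<close> with \<open>i\<close> and
  \<open>k\<close>.\<close>

lemma equiv_parallel_rel:
  assumes M: "matroid E \<I>" and ST: "S \<union> T \<subseteq> E"
  shows "equiv S (parallel_rel \<I> T S)"
proof (rule equivI)
  show "parallel_rel \<I> T S \<subseteq> S \<times> S" by (auto simp: parallel_rel_def)
  show "refl_on S (parallel_rel \<I> T S)" by (auto simp: refl_on_def parallel_rel_def)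
  show "sym (parallel_rel \<I> T S)" by (auto simp: sym_def parallel_rel_def insert_commute)
  show "trans (parallel_rel \<I> T S)"
  proof (rule transI)
    fix i j k assume ij: "(i, j) \<in> parallel_rel \<I> T S" and jk: "(j, k) \<in> parallel_rel \<I> T S"
    show "(i, k) \<in> parallel_rel \<I> T S"
    proof (cases "i = j \<or> j = k")
      case True
      then show ?thesis using ij jk by auto
    next
      case False
      let ?r = "matroid_rank \<I>"
      have S: "i \<in> S" "j \<in> S" "k \<in> S"
        and r: "?r (insert i T) = Suc (?r T)" "?r (insert j T) = Suc (?r T)"
          "?r (insert k T) = Suc (?r T)" "?r (insert i (insert j T)) = Suc (?r T)"
          "?r (insert j (insert k T)) = Suc (?r T)"
        using ij jk False by (auto simp: parallel_rel_def)
      have "?r (insert i (insert k (insert j T))) = ?r (insert k (insert j T))"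
        by (rule matroid_rank_insert_eq_superset[OF M, of "insert j T"]) (use S ST r in auto)
      moreover have "?r (insert i (insert k T)) \<le> ?r (insert i (insert k (insert j T)))"
        by (rule matroid_rank_mono[OF M]) (use S ST in auto)
      moreover have "?r (insert i T) \<le> ?r (insert i (insert k T))"
        by (rule matroid_rank_mono[OF M]) (use S ST in auto)
      ultimately have "?r (insert i (insert k T)) = Suc (?r T)"
        using r by (simp add: insert_commute)
      then show ?thesis using S r by (simp add: parallel_rel_def)
    qed
  qed
qed

text \<open>The defect of modularity on two elements is 1 exactly for parallel non-loops. This is
  the source of the entries \<open>q\<close> and 1 in the degree 2 form.\<close>

lemma matroid_rank_insert2:
  assumes M: "matroid E \<I>" and ST: "S \<union> T \<subseteq> E" and S: "i \<in> S" "j \<in> S" "i \<noteq> j"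
  shows "int (matroid_rank \<I> (insert i T)) + int (matroid_rank \<I> (insert j T)) =
    int (matroid_rank \<I> T) + int (matroid_rank \<I> (insert i (insert j T))) +
    (if (i, j) \<in> parallel_rel \<I> T S then 1 else 0)"
proof -
  let ?r = "matroid_rank \<I>"
  have le: "?r T \<le> ?r (insert i T)" "?r (insert i T) \<le> Suc (?r T)"
    "?r T \<le> ?r (insert j T)" "?r (insert j T) \<le> Suc (?r T)"
    "?r (insert i T) \<le> ?r (insert i (insert j T))"
    "?r (insert i (insert j T)) \<le> Suc (?r (insert j T))"
    by (rule matroid_rank_mono[OF M] matroid_rank_insert_le[OF M]; use S ST in blast)+
  consider "?r (insert i T) = ?r T" | "?r (insert j T) = ?r T"
    | "?r (insert i T) = Suc (?r T)" "?r (insert j T) = Suc (?r T)"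
    using le by linarith
  then show ?thesis
  proof cases
    case 1
    have "?r (insert i (insert j T)) = ?r (insert j T)"
      by (rule matroid_rank_insert_eq_superset[OF M, of T]) (use S ST 1 in auto)
    then show ?thesis using 1 S by (simp add: parallel_rel_def)
  next
    case 2
    have "?r (insert j (insert i T)) = ?r (insert i T)"
      by (rule matroid_rank_insert_eq_superset[OF M, of T]) (use S ST 2 in auto)
    then show ?thesis using 2 S by (simp add: parallel_rel_def insert_commute)
  next
    case 3
    then show ?thesis using S le by (auto simp: parallel_rel_def)
  qed
qed

section \<open>Generating polynomials truncated by degree\<close>

text \<open>The powers of \<open>w 0\<close> are divided by factorials so that differentiating by
  \<open>w 0\<close> changes only \<open>d\<close>. Sets with more than \<open>d\<close> elements
  must be excluded explicitly, since \<open>d - card A\<close> would be 0 for them.\<close>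

definition gen_poly ::
    "nat set \<Rightarrow> (nat set \<Rightarrow> real) \<Rightarrow> (nat \<Rightarrow> real) \<Rightarrow> nat \<Rightarrow> (nat \<Rightarrow> real) \<Rightarrow> real" where
  "gen_poly S r c d w = (\<Sum>A | A \<subseteq> S \<and> card A \<le> d.
     c (card A) * r A * (\<Prod>i\<in>A. w i) * (w 0 ^ (d - card A) / fact (d - card A)))"

lemma finite_small_subsets [simp]: "finite S \<Longrightarrow> finite {A. A \<subseteq> S \<and> card A \<le> d}"
  by (rule finite_subset[of _ "Pow S"]) auto

lemma gen_poly_degree_0:
  assumes "finite S"
  shows "gen_poly S r c 0 w = c 0 * r {}"
proof -
  have "{A. A \<subseteq> S \<and> card A \<le> 0} = {{}}"
    using assms by (auto simp: card_eq_0_iff dest: finite_subset)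
  then show ?thesis by (simp add: gen_poly_def)
qed

lemma partial_const [simp]: "partial i (\<lambda>_. a) = (\<lambda>_. 0)"
  by (simp add: partial_def fun_eq_iff)

lemma partial_0_gen_poly:
  assumes S: "finite S" "0 \<notin> S"
  shows "partial 0 (gen_poly S r c (Suc d)) = gen_poly S r c d"
proof
  fix w :: "nat \<Rightarrow> real"
  define k where "k A = c (card A) * r A * (\<Prod>i\<in>A. w i)" for A
  have upd: "gen_poly S r c (Suc d) (w(0 := t)) =
    (\<Sum>A | A \<subseteq> S \<and> card A \<le> Suc d. k A * (t ^ (Suc d - card A) / fact (Suc d - card A)))" for t
    unfolding gen_poly_def k_def
  proof (intro sum.cong refl)
    fix A assume "A \<in> {A. A \<subseteq> S \<and> card A \<le> Suc d}"
    then have "(\<Prod>i\<in>A. (w(0 := t)) i) = (\<Prod>i\<in>A. w i)"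
      using S by (intro prod.cong) auto
    then show "c (card A) * r A * (\<Prod>i\<in>A. (w(0 := t)) i) *
        ((w(0 := t)) 0 ^ (Suc d - card A) / fact (Suc d - card A)) =
      c (card A) * r A * (\<Prod>i\<in>A. w i) * (t ^ (Suc d - card A) / fact (Suc d - card A))"
      by simp
  qed
  have "((\<lambda>t. \<Sum>A | A \<subseteq> S \<and> card A \<le> Suc d.
          k A * (t ^ (Suc d - card A) / fact (Suc d - card A))) has_field_derivative
       (\<Sum>A | A \<subseteq> S \<and> card A \<le> Suc d.
          k A * (real (Suc d - card A) * w 0 ^ (Suc d - card A - Suc 0) / fact (Suc d - card A)))) (at (w 0))"
    by (intro DERIV_sum) (auto intro!: derivative_eq_intros)
  then have "partial 0 (gen_poly S r c (Suc d)) w = (\<Sum>A | A \<subseteq> S \<and> card A \<le> Suc d.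
      k A * (real (Suc d - card A) * w 0 ^ (Suc d - card A - Suc 0) / fact (Suc d - card A)))"
    unfolding partial_def upd by (rule DERIV_imp_deriv)
  also have "\<dots> = (\<Sum>A | A \<subseteq> S \<and> card A \<le> d. k A * (w 0 ^ (d - card A) / fact (d - card A)))"
  proof (rule sum.mono_neutral_cong_right)
    show "\<forall>A\<in>{A. A \<subseteq> S \<and> card A \<le> Suc d} - {A. A \<subseteq> S \<and> card A \<le> d}.
      k A * (real (Suc d - card A) * w 0 ^ (Suc d - card A - Suc 0) / fact (Suc d - card A)) = 0"
      by auto
    fix A assume "A \<in> {A. A \<subseteq> S \<and> card A \<le> d}"
    then have "Suc d - card A = Suc (d - card A)" by auto
    then show "k A * (real (Suc d - card A) * w 0 ^ (Suc d - card A - Suc 0) / fact (Suc d - card A))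
      = k A * (w 0 ^ (d - card A) / fact (d - card A))"
      by (simp del: of_nat_Suc)
  qed (use S in auto)
  finally show "partial 0 (gen_poly S r c (Suc d)) w = gen_poly S r c d w"
    by (simp add: gen_poly_def k_def)
qed

text \<open>Collects the monomials divisible by \<open>w i\<close>; both the derivative by
  \<open>w i\<close> and Euler's identity rest on this grouping.\<close>

lemma gen_poly_terms_with:
  assumes S: "finite S" "0 \<notin> S" and i: "i \<in> S"
  shows "(\<Sum>A | A \<subseteq> S \<and> card A \<le> Suc d \<and> i \<in> A.
       c (card A) * r A * (\<Prod>j\<in>A. w j) * (w 0 ^ (Suc d - card A) / fact (Suc d - card A)))
    = w i * gen_poly (S - {i}) (\<lambda>A. r (insert i A)) (\<lambda>k. c (Suc k)) d w"
proof -
  have "bij_betw (insert i) {B. B \<subseteq> S - {i} \<and> card B \<le> d} {A. A \<subseteq> S \<and> card A \<le> Suc d \<and> i \<in> A}"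
  proof (rule bij_betwI[where g = "\<lambda>A. A - {i}"])
    show "insert i \<in> {B. B \<subseteq> S - {i} \<and> card B \<le> d} \<rightarrow> {A. A \<subseteq> S \<and> card A \<le> Suc d \<and> i \<in> A}"
      using S i by (auto simp: card_insert_if dest: finite_subset)
    show "(\<lambda>A. A - {i}) \<in> {A. A \<subseteq> S \<and> card A \<le> Suc d \<and> i \<in> A} \<rightarrow> {B. B \<subseteq> S - {i} \<and> card B \<le> d}"
      by (auto simp: card_Diff_singleton_if)
  qed auto
  then have "(\<Sum>A | A \<subseteq> S \<and> card A \<le> Suc d \<and> i \<in> A.
       c (card A) * r A * (\<Prod>j\<in>A. w j) * (w 0 ^ (Suc d - card A) / fact (Suc d - card A)))
     = (\<Sum>B | B \<subseteq> S - {i} \<and> card B \<le> d. c (card (insert i B)) * r (insert i B) *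
         (\<Prod>j\<in>insert i B. w j) * (w 0 ^ (Suc d - card (insert i B)) / fact (Suc d - card (insert i B))))"
    by (rule sum.reindex_bij_betw[symmetric])
  also have "\<dots> = w i * gen_poly (S - {i}) (\<lambda>A. r (insert i A)) (\<lambda>k. c (Suc k)) d w"
    unfolding gen_poly_def sum_distrib_left
  proof (intro sum.cong refl)
    fix B assume B: "B \<in> {B. B \<subseteq> S - {i} \<and> card B \<le> d}"
    then have "finite B" "i \<notin> B" using S by (auto intro: finite_subset)
    then show "c (card (insert i B)) * r (insert i B) * (\<Prod>j\<in>insert i B. w j) *
        (w 0 ^ (Suc d - card (insert i B)) / fact (Suc d - card (insert i B)))
      = w i * (c (Suc (card B)) * r (insert i B) * (\<Prod>j\<in>B. w j) * (w 0 ^ (d - card B) / fact (d - card B)))"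
      by (simp add: mult_ac)
  qed
  finally show ?thesis .
qed

lemma gen_poly_upd_other:
  assumes "i \<notin> S" "i \<noteq> 0"
  shows "gen_poly S r c d (w(i := t)) = gen_poly S r c d w"
  unfolding gen_poly_def
proof (intro sum.cong refl)
  fix A assume "A \<in> {A. A \<subseteq> S \<and> card A \<le> d}"
  then have "(\<Prod>j\<in>A. (w(i := t)) j) = (\<Prod>j\<in>A. w j)"
    using assms by (intro prod.cong) auto
  then show "c (card A) * r A * (\<Prod>j\<in>A. (w(i := t)) j) * ((w(i := t)) 0 ^ (d - card A) / fact (d - card A)) =
      c (card A) * r A * (\<Prod>j\<in>A. w j) * (w 0 ^ (d - card A) / fact (d - card A))"
    using assms by simp
qed

lemma partial_other_gen_poly:
  assumes "i \<notin> S" "i \<noteq> 0"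
  shows "partial i (gen_poly S r c d) = (\<lambda>_. 0)"
  using assms by (simp add: partial_def fun_eq_iff gen_poly_upd_other)

lemma gen_poly_upd:
  assumes S: "finite S" "0 \<notin> S" and i: "i \<in> S"
  shows "gen_poly S r c (Suc d) (w(i := t)) =
    gen_poly (S - {i}) r c (Suc d) w + t * gen_poly (S - {i}) (\<lambda>A. r (insert i A)) (\<lambda>k. c (Suc k)) d w"
proof -
  let ?v = "w(i := t)"
  let ?f = "\<lambda>A. c (card A) * r A * (\<Prod>j\<in>A. ?v j) * (?v 0 ^ (Suc d - card A) / fact (Suc d - card A))"
  have "{A. A \<subseteq> S \<and> card A \<le> Suc d} =
      {A. A \<subseteq> S - {i} \<and> card A \<le> Suc d} \<union> {A. A \<subseteq> S \<and> card A \<le> Suc d \<and> i \<in> A}"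
    by auto
  then have "gen_poly S r c (Suc d) ?v =
      sum ?f ({A. A \<subseteq> S - {i} \<and> card A \<le> Suc d} \<union> {A. A \<subseteq> S \<and> card A \<le> Suc d \<and> i \<in> A})"
    unfolding gen_poly_def by simp
  also have "\<dots> = gen_poly (S - {i}) r c (Suc d) ?v + sum ?f {A. A \<subseteq> S \<and> card A \<le> Suc d \<and> i \<in> A}"
    unfolding gen_poly_def
  proof (rule sum.union_disjoint)
    show "finite {A. A \<subseteq> S \<and> card A \<le> Suc d \<and> i \<in> A}"
      by (rule finite_subset[of _ "Pow S"]) (use S in auto)
  qed (use S in auto)
  also have "sum ?f {A. A \<subseteq> S \<and> card A \<le> Suc d \<and> i \<in> A} =
      ?v i * gen_poly (S - {i}) (\<lambda>A. r (insert i A)) (\<lambda>k. c (Suc k)) d ?v"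
    by (rule gen_poly_terms_with[OF S i])
  finally have "gen_poly S r c (Suc d) ?v = gen_poly (S - {i}) r c (Suc d) ?v +
      t * gen_poly (S - {i}) (\<lambda>A. r (insert i A)) (\<lambda>k. c (Suc k)) d ?v"
    unfolding fun_upd_same .
  moreover have "gen_poly (S - {i}) r' c' d' ?v = gen_poly (S - {i}) r' c' d' w" for r' c' d'
    by (intro gen_poly_upd_other) (use S i in \<open>auto intro: gr0I\<close>)
  ultimately show ?thesis by simp
qed

lemma partial_gen_poly:
  assumes S: "finite S" "0 \<notin> S" and i: "i \<in> S"
  shows "partial i (gen_poly S r c (Suc d)) = gen_poly (S - {i}) (\<lambda>A. r (insert i A)) (\<lambda>k. c (Suc k)) d"
proof
  fix w :: "nat \<Rightarrow> real"
  have "((\<lambda>t. a + t * b) has_field_derivative b) (at (w i))" for a b :: real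
    by (auto intro!: derivative_eq_intros)
  then show "partial i (gen_poly S r c (Suc d)) w =
      gen_poly (S - {i}) (\<lambda>A. r (insert i A)) (\<lambda>k. c (Suc k)) d w"
    unfolding partial_def gen_poly_upd[OF S i] by (intro DERIV_imp_deriv)
qed

text \<open>Homogeneity by counting: the monomial of \<open>A\<close> is reproduced
  \<open>card A\<close> times by the variables in \<open>S\<close> and \<open>Suc d - card A\<close>
  times by \<open>w 0\<close>.\<close>

lemma gen_poly_Euler:
  assumes S: "finite S" "0 \<notin> S"
  shows "w 0 * partial 0 (gen_poly S r c (Suc d)) w + (\<Sum>i\<in>S. w i * partial i (gen_poly S r c (Suc d)) w)
    = real (Suc d) * gen_poly S r c (Suc d) w"
proof -
  let ?F = "{A. A \<subseteq> S \<and> card A \<le> Suc d}"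
  define m where "m A = c (card A) * r A * (\<Prod>j\<in>A. w j) *
    (w 0 ^ (Suc d - card A) / fact (Suc d - card A))" for A
  have G: "gen_poly S r c (Suc d) w = sum m ?F"
    by (simp add: gen_poly_def m_def)
  have "(\<Sum>i\<in>S. w i * partial i (gen_poly S r c (Suc d)) w)
      = (\<Sum>i\<in>S. \<Sum>A | A \<subseteq> S \<and> card A \<le> Suc d \<and> i \<in> A. m A)"
    unfolding m_def by (intro sum.cong refl) (simp only: partial_gen_poly[OF S] gen_poly_terms_with[OF S])
  also have "\<dots> = (\<Sum>i\<in>S. \<Sum>A\<in>?F. if i \<in> A then m A else 0)"
  proof (rule sum.cong)
    fix i
    have eq: "{A. A \<subseteq> S \<and> card A \<le> Suc d \<and> i \<in> A} = {A \<in> ?F. i \<in> A}" by auto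
    show "(\<Sum>A | A \<subseteq> S \<and> card A \<le> Suc d \<and> i \<in> A. m A) = (\<Sum>A\<in>?F. if i \<in> A then m A else 0)"
      unfolding eq by (rule sum.inter_filter) (use S in simp)
  qed simp
  also have "\<dots> = (\<Sum>A\<in>?F. \<Sum>i\<in>S. if i \<in> A then m A else 0)"
    by (rule sum.swap)
  also have "\<dots> = (\<Sum>A\<in>?F. real (card A) * m A)"
  proof (intro sum.cong refl)
    fix A assume "A \<in> ?F"
    then have "{i \<in> S. i \<in> A} = A" by auto
    then show "(\<Sum>i\<in>S. if i \<in> A then m A else 0) = real (card A) * m A"
      using S by (simp flip: sum.inter_filter)
  qed
  finally have sumS: "(\<Sum>i\<in>S. w i * partial i (gen_poly S r c (Suc d)) w) = (\<Sum>A\<in>?F. real (card A) * m A)" .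
  have "w 0 * gen_poly S r c d w = (\<Sum>A\<in>?F. (real (Suc d) - real (card A)) * m A)"
    unfolding gen_poly_def sum_distrib_left
  proof (rule sum.mono_neutral_cong_left)
    show "\<forall>A\<in>?F - {A. A \<subseteq> S \<and> card A \<le> d}. (real (Suc d) - real (card A)) * m A = 0"
    proof
      fix A assume "A \<in> ?F - {A. A \<subseteq> S \<and> card A \<le> d}"
      then have "card A = Suc d" by auto
      then show "(real (Suc d) - real (card A)) * m A = 0" by simp
    qed
    fix A assume "A \<in> {A. A \<subseteq> S \<and> card A \<le> d}"
    then obtain e where e: "d = card A + e" by (auto simp: le_iff_add)
    show "w 0 * (c (card A) * r A * (\<Prod>j\<in>A. w j) * (w 0 ^ (d - card A) / fact (d - card A)))
      = (real (Suc d) - real (card A)) * m A"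
    proof -
      have "real (Suc d) - real (card A) = real (Suc e)" "Suc d - card A = Suc e" "d - card A = e"
        using e by auto
      then show ?thesis unfolding m_def
        by (simp del: of_nat_Suc)
    qed
  qed (use S in auto)
  then have "w 0 * partial 0 (gen_poly S r c (Suc d)) w + (\<Sum>i\<in>S. w i * partial i (gen_poly S r c (Suc d)) w)
      = (\<Sum>A\<in>?F. (real (Suc d) - real (card A)) * m A + real (card A) * m A)"
    by (simp only: partial_0_gen_poly[OF S] sumS sum.distrib)
  also have "\<dots> = real (Suc d) * gen_poly S r c (Suc d) w"
    unfolding G sum_distrib_left by (intro sum.cong refl) (simp add: algebra_simps)
  finally show ?thesis .
qed

lemma gen_poly_pos:
  assumes S: "finite S" and w: "\<And>i. i \<in> insert 0 S \<Longrightarrow> w i > 0"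
    and c: "\<And>k. k \<le> card S \<Longrightarrow> c k > 0" and r: "\<And>A. A \<subseteq> S \<Longrightarrow> r A > 0"
  shows "gen_poly S r c d w > 0"
  unfolding gen_poly_def
proof (rule sum_pos)
  show "{A. A \<subseteq> S \<and> card A \<le> d} \<noteq> {}" by (auto intro: exI[of _ "{}"])
  fix A assume "A \<in> {A. A \<subseteq> S \<and> card A \<le> d}"
  then have "A \<subseteq> S" by simp
  then have "c (card A) > 0" "r A > 0" "(\<Prod>i\<in>A. w i) > 0"
    using w r c[OF card_mono[OF S]] by (auto intro!: prod_pos)
  then show "0 < c (card A) * r A * (\<Prod>i\<in>A. w i) * (w 0 ^ (d - card A) / fact (d - card A))"
    using w by simp
qed (use S in simp)

section \<open>A class of polynomials closed under differentiation\<close>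

text \<open>\<open>V\<close> only bounds the variables, so that derivatives in different directions
  share one index set; zero is included because repeated or absent variables produce it.\<close>

definition gen_poly_class :: "nat set \<Rightarrow> nat \<Rightarrow> ((nat \<Rightarrow> real) \<Rightarrow> real) \<Rightarrow> bool" where
  "gen_poly_class V d f \<longleftrightarrow> f = (\<lambda>_. 0) \<or>
     (\<exists>S r c. finite S \<and> 0 \<notin> S \<and> insert 0 S \<subseteq> V \<and> (\<forall>A\<subseteq>S. r A > 0) \<and>
        (\<forall>k\<le>card S. c k > 0) \<and> f = gen_poly S r c d)"

lemma gen_poly_class_zero: "gen_poly_class V d (\<lambda>_. 0)"
  by (simp add: gen_poly_class_def)

lemma gen_poly_classI:
  assumes "finite S" "0 \<notin> S" "insert 0 S \<subseteq> V"
    and "\<And>A. A \<subseteq> S \<Longrightarrow> r A > 0" "\<And>k. k \<le> card S \<Longrightarrow> c k > 0"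
  shows "gen_poly_class V d (gen_poly S r c d)"
  using assms unfolding gen_poly_class_def by blast

lemma gen_poly_classE:
  assumes "gen_poly_class V d f"
  obtains "f = (\<lambda>_. 0)"
  | S r c where "finite S" "0 \<notin> S" "insert 0 S \<subseteq> V" "f = gen_poly S r c d"
     "\<And>A. A \<subseteq> S \<Longrightarrow> r A > 0" "\<And>k. k \<le> card S \<Longrightarrow> c k > 0"
  using assms unfolding gen_poly_class_def by blast

lemma gen_poly_class_partial:
  assumes "gen_poly_class V (Suc d) f"
  shows "gen_poly_class V d (partial i f)"
  using assms
proof (cases rule: gen_poly_classE)
  case 1
  then show ?thesis by (simp add: gen_poly_class_zero)
next
  case (2 S r c)
  consider "i = 0" | "i \<in> S" | "i \<notin> S" "i \<noteq> 0" by blast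
  then show ?thesis
  proof cases
    case 1
    have "gen_poly_class V d (gen_poly S r c d)"
      by (rule gen_poly_classI) (use 2 in auto)
    then show ?thesis using 1 2 by (simp add: partial_0_gen_poly)
  next
    case i: 2
    have "gen_poly_class V d (gen_poly (S - {i}) (\<lambda>A. r (insert i A)) (\<lambda>k. c (Suc k)) d)"
    proof (rule gen_poly_classI)
      show "c (Suc k) > 0" if "k \<le> card (S - {i})" for k
        using that 2 i card_Suc_Diff1[of S i] by (intro 2(6)) auto
      show "r (insert i A) > 0" if "A \<subseteq> S - {i}" for A
        using that i by (intro 2(5)) auto
    qed (use 2 i in auto)
    then show ?thesis using i 2 by (simp add: partial_gen_poly)
  next
    case 3
    then show ?thesis using 2 by (simp add: partial_other_gen_poly gen_poly_class_zero)
  qed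
qed

lemma gen_poly_class_nonneg:
  assumes "gen_poly_class V d f" and w: "\<And>i. i \<in> V \<Longrightarrow> w i > 0"
  shows "f w \<ge> 0"
  using assms(1)
proof (cases rule: gen_poly_classE)
  case (2 S r c)
  have "gen_poly S r c d w > 0"
    by (rule gen_poly_pos) (use 2 w in auto)
  then show ?thesis using 2 by simp
qed simp

lemma gen_poly_class_Euler:
  assumes "gen_poly_class V (Suc d) f" "finite V"
  shows "(\<Sum>i\<in>V. w i * partial i f w) = real (Suc d) * f w"
  using assms(1)
proof (cases rule: gen_poly_classE)
  case 1
  then show ?thesis by simp
next
  case (2 S r c)
  have "(\<Sum>i\<in>V. w i * partial i f w) = (\<Sum>i\<in>insert 0 S. w i * partial i f w)"
    using 2 assms(2) by (intro sum.mono_neutral_right) (auto simp: partial_other_gen_poly)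
  then show ?thesis using 2 gen_poly_Euler[of S w r c d] by (simp del: of_nat_Suc)
qed

lemma gen_poly_class_commute:
  assumes "gen_poly_class V (Suc (Suc d)) f"
  shows "partial i (partial j f) = partial j (partial i f)"
  using assms
proof (cases rule: gen_poly_classE)
  case 1
  then show ?thesis by simp
next
  case (2 S r c)
  note S = \<open>finite S\<close> \<open>0 \<notin> S\<close>
  have both: "partial i (partial j f) = partial j (partial i f)" if "i \<in> S" "j \<in> S" "i \<noteq> j" for i j
  proof -
    have "S - {j} - {i} = S - {i} - {j}" by blast
    moreover have "finite (S - {k})" "0 \<notin> S - {k}" for k using S by auto
    ultimately show ?thesis
      using that S by (simp add: 2(4) partial_gen_poly insert_commute)
  qed
  have zero: "partial 0 (partial j f) = partial j (partial 0 f)" if "j \<in> S" for j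
    using that S by (simp add: 2(4) partial_gen_poly partial_0_gen_poly)
  have other: "partial i (partial j f) = partial j (partial i f)" if "i \<notin> insert 0 S" for i j
  proof -
    have i: "i \<noteq> 0" "i \<notin> S" "i \<notin> S - {j}" using that by auto
    consider "j = 0" | "j \<in> S" | "j \<noteq> 0" "j \<notin> S" by blast
    then show ?thesis
      using S i by cases (simp_all add: 2(4) partial_gen_poly partial_0_gen_poly partial_other_gen_poly)
  qed
  consider "i = j" | "i \<notin> insert 0 S" | "j \<notin> insert 0 S" | "i = 0" "j \<in> S" | "j = 0" "i \<in> S"
    | "i \<in> S" "j \<in> S" "i \<noteq> j" by blast
  then show ?thesis
  proof cases
    case 2
    then show ?thesis by (rule other)
  next
    case 3
    then show ?thesis by (rule other[symmetric])
  next
    case 6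
    then show ?thesis by (rule both)
  qed (auto simp: zero)
qed

section \<open>Hessians of the generating polynomials\<close>

text \<open>Supplies the positive row that \<open>negative_definite_step\<close> needs at the
  distinguished index.\<close>

lemma hessian_gen_poly_row_0_pos:
  assumes S: "finite S" "0 \<notin> S" and w: "\<And>i. i \<in> insert 0 S \<Longrightarrow> w i > 0"
    and c: "\<And>k. k \<le> card S \<Longrightarrow> c k > 0" and r: "\<And>A. A \<subseteq> S \<Longrightarrow> r A > 0"
    and j: "j \<in> insert 0 S"
  shows "partial 0 (partial j (gen_poly S r c (Suc (Suc d)))) w > 0"
proof (cases "j = 0")
  case True
  then show ?thesis
    using assms by (auto simp: partial_0_gen_poly intro!: gen_poly_pos)
next
  case False
  then have j: "j \<in> S" using j by simp
  have "gen_poly (S - {j}) (\<lambda>A. r (insert j A)) (\<lambda>k. c (Suc k)) d w > 0"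
  proof (rule gen_poly_pos)
    show "c (Suc k) > 0" if "k \<le> card (S - {j})" for k
      using that S j card_Suc_Diff1[of S j] by (intro c) auto
    show "r (insert j A) > 0" if "A \<subseteq> S - {j}" for A
      using that j by (intro r) auto
  qed (use S w in auto)
  then show ?thesis using j S by (simp add: partial_gen_poly partial_0_gen_poly)
qed

text \<open>Up to the constant factor \<open>q powi (- int (matroid_rank \<I> T))\<close> this is
  the weight of the contraction by \<open>T\<close>; keeping the factor avoids defining
  contractions.\<close>

abbreviation rank_weight :: "real \<Rightarrow> nat set set \<Rightarrow> nat set \<Rightarrow> nat set \<Rightarrow> real" where
  "rank_weight q \<I> T \<equiv> \<lambda>A. q powi (- int (matroid_rank \<I> (A \<union> T)))"

text \<open>With \<open>y i = r {i} / r {} * x i\<close> the Hessian becomes \<open>r {}\<close> times the form of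
  \<open>negative_quadratic_form_of_parallel_classes\<close>.\<close>

lemma hessian_negative_definite_degree_2:
  assumes M: "matroid E \<I>" and S: "finite S" "0 \<notin> S" and ST: "S \<union> T \<subseteq> E"
    and q: "0 < q" "q \<le> 1" and w: "\<And>i. i \<in> insert 0 S \<Longrightarrow> w i > 0"
    and card: "2 \<le> card S"
    and c: "\<And>k. k \<le> card S \<Longrightarrow> c k > 0"
    and lc: "(c 1)\<^sup>2 * real (card S) > c 0 * c 2 * (real (card S) - 1)"
  defines "H \<equiv> \<lambda>i j. partial i (partial j (gen_poly S (rank_weight q \<I> T) c (Suc (Suc 0)))) w"
  assumes orth: "bilin (insert 0 S) H x w = 0" and nz: "\<exists>i\<in>insert 0 S. x i \<noteq> 0"
  shows "bilin (insert 0 S) H x x < 0"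
proof -
  define r where "r = rank_weight q \<I> T"
  define R where "R = parallel_rel \<I> T S"
  have rpos: "r A > 0" for A using q by (simp add: r_def)
  have S0: "0 < j" if "j \<in> S" for j using that S by (cases j) auto
  have H00: "H 0 0 = c 0 * r {}"
    using S by (simp add: H_def r_def partial_0_gen_poly gen_poly_degree_0)
  have H0j: "H 0 j = c 1 * r {j}" "H j 0 = c 1 * r {j}" if "j \<in> S" for j
    using S S0 that by (simp_all add: H_def r_def partial_0_gen_poly partial_gen_poly gen_poly_degree_0)
  have Hii: "H j j = 0" if "j \<in> S" for j
    using that S S0 by (simp add: H_def partial_gen_poly partial_other_gen_poly)
  have Hij: "H i j = c 2 * r {i, j}" if "i \<in> S" "j \<in> S" "i \<noteq> j" for i j
    using S that by (simp add: H_def r_def partial_gen_poly gen_poly_degree_0 insert_commute numeral_2_eq_2)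
  have sym: "H i j = H j i" if "i \<in> insert 0 S" "j \<in> insert 0 S" for i j
    using that H0j[of i] H0j[of j] Hij[of i j] Hij[of j i] by (cases "i = j") (auto simp: insert_commute)
  \<comment> \<open>The two-element rank formula in multiplicative form.\<close>
  have rij: "r {i, j} * r {} = (if (i, j) \<in> R then q else 1) * (r {i} * r {j})"
    if "i \<in> S" "j \<in> S" "i \<noteq> j" for i j
  proof -
    let ?\<rho> = "\<lambda>A. int (matroid_rank \<I> A)"
    define \<delta> where "\<delta> = (if (i, j) \<in> R then 1 else 0 :: int)"
    have eq: "?\<rho> (insert i T) + ?\<rho> (insert j T) = ?\<rho> T + ?\<rho> (insert i (insert j T)) + \<delta>"
      using matroid_rank_insert2[OF M ST that] by (simp only: \<delta>_def R_def)
    have powi_add: "q powi (a + b) = q powi a * q powi b" for a b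
      using q by (simp add: power_int_add)
    have "r {i, j} * r {} = q powi (- ?\<rho> (insert i (insert j T)) + - ?\<rho> T)"
      unfolding powi_add by (simp add: r_def)
    also have "- ?\<rho> (insert i (insert j T)) + - ?\<rho> T = \<delta> + (- ?\<rho> (insert i T) + - ?\<rho> (insert j T))"
      using eq by simp
    also have "q powi \<dots> = q powi \<delta> * (r {i} * r {j})"
      unfolding powi_add by (simp add: r_def)
    also have "q powi \<delta> = (if (i, j) \<in> R then q else 1)" by (simp add: \<delta>_def)
    finally show ?thesis .
  qed
  \<comment> \<open>The hyperplane \<open>plane\<close> is the kernel of row 0 of \<open>H\<close>,
    where completing the square in \<open>w 0\<close> applies;
    \<open>negative_definite_on_orthogonal\<close> later exchanges it for the complement of
    \<open>w\<close>.\<close>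
  have neg: "bilin (insert 0 S) H x x < 0"
    if plane: "(\<Sum>i\<in>insert 0 S. (if i = 0 then c 0 * r {} else c 1 * r {i}) * x i) = 0"
      and nz: "\<exists>i\<in>insert 0 S. x i \<noteq> 0" for x
  proof -
    define y where "y i = r {i} / r {} * x i" for i
    have yx: "r {i} * x i = r {} * y i" for i using rpos[of "{}"] by (simp add: y_def)
    have sumS: "(\<Sum>i\<in>S. (if i = 0 then c 0 * r {} else c 1 * r {i}) * x i) = r {} * (c 1 * (\<Sum>i\<in>S. y i))"
      unfolding sum_distrib_left using S
      by (intro sum.cong refl) (use yx in \<open>auto simp: mult_ac\<close>)
    have "c 0 * r {} * x 0 + r {} * (c 1 * (\<Sum>i\<in>S. y i)) = 0"
      using plane by (simp only: sum.insert[OF S] sumS simp_thms if_True)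
    then have "r {} * (c 0 * x 0 + c 1 * (\<Sum>i\<in>S. y i)) = 0" by (simp only: algebra_simps)
    then have plane': "c 0 * x 0 + c 1 * (\<Sum>i\<in>S. y i) = 0"
      using rpos[of "{}"] by (simp only: mult_eq_0_iff) simp
    have nz': "x 0 \<noteq> 0 \<or> (\<exists>i\<in>S. y i \<noteq> 0)"
      using nz rpos by (auto simp: y_def less_imp_neq[THEN not_sym])
    have row: "(\<Sum>j\<in>S. H 0 j * x j) = r {} * (c 1 * (\<Sum>i\<in>S. y i))"
      unfolding sum_distrib_left
      by (intro sum.cong refl) (use yx in \<open>auto simp: H0j mult_ac\<close>)
    have SS: "bilin S H x x = r {} * (c 2 * (\<Sum>i\<in>S. \<Sum>j\<in>S.
        (if i = j then 0 else if (i, j) \<in> R then q else 1) * (y i * y j)))"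
      unfolding bilin_def sum_distrib_left
    proof (intro sum.cong refl)
      fix i j assume ij: "i \<in> S" "j \<in> S"
      show "H i j * x i * x j =
        r {} * (c 2 * ((if i = j then 0 else if (i, j) \<in> R then q else 1) * (y i * y j)))"
      proof (cases "i = j")
        case True
        then show ?thesis using ij by (simp add: Hii)
      next
        case False
        have r0: "r {} \<noteq> 0" using rpos[of "{}"] by simp
        have "r {} * (c 2 * ((if (i, j) \<in> R then q else 1) * (y i * y j))) =
          c 2 * ((if (i, j) \<in> R then q else 1) * (r {i} * r {j})) * x i * x j / r {}"
          using r0 by (simp add: y_def field_simps)
        also have "\<dots> = c 2 * r {i, j} * x i * x j"
          unfolding rij[OF ij False, symmetric] using r0 by simp
        finally show ?thesis by (simp only: Hij[OF ij False] if_not_P[OF False])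
      qed
    qed
    have "bilin (insert 0 S) H x x = r {} * (c 0 * (x 0)\<^sup>2 + 2 * c 1 * x 0 * (\<Sum>i\<in>S. y i) +
      c 2 * (\<Sum>i\<in>S. \<Sum>j\<in>S. (if i = j then 0 else if (i, j) \<in> R then q else 1) * (y i * y j)))"
    proof -
      have "bilin (insert 0 S) H x x = H 0 0 * (x 0)\<^sup>2 + 2 * x 0 * (\<Sum>j\<in>S. H 0 j * x j) + bilin S H x x"
        by (rule bilin_insert_self[OF S]) (use sym in auto)
      then show ?thesis unfolding row SS H00 by (simp only: algebra_simps)
    qed
    also have "\<dots> < 0"
    proof (rule mult_pos_neg[OF rpos])
      show "c 0 * (x 0)\<^sup>2 + 2 * c 1 * x 0 * (\<Sum>i\<in>S. y i) +
        c 2 * (\<Sum>i\<in>S. \<Sum>j\<in>S. (if i = j then 0 else if (i, j) \<in> R then q else 1) * (y i * y j)) < 0"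
        by (rule negative_quadratic_form_of_parallel_classes[OF S(1) _ q _ _ _ lc plane' nz'])
          (use equiv_parallel_rel[OF M ST] c card in \<open>auto simp: R_def\<close>)
    qed
    finally show ?thesis .
  qed
  have Hnn: "H i j \<ge> 0" if "i \<in> insert 0 S" "j \<in> insert 0 S" for i j
  proof -
    have "c 0 > 0" "c 1 > 0" "c 2 > 0" using c card by auto
    then show ?thesis
      using that rpos by (cases "i = j"; cases "i = 0"; cases "j = 0")
        (auto simp: H00 H0j Hii Hij intro!: less_imp_le mult_pos_pos)
  qed
  have "0 < H 0 0 * w 0 * w 0" using c[of 0] rpos[of "{}"] w by (simp add: H00)
  also have "\<dots> \<le> (\<Sum>j\<in>insert 0 S. H 0 j * w 0 * w j)"
    by (rule member_le_sum[of 0 _ "\<lambda>j. H 0 j * w 0 * w j"])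
      (use S Hnn w in \<open>auto intro!: mult_nonneg_nonneg intro: less_imp_le\<close>)
  also have "\<dots> \<le> bilin (insert 0 S) H w w"
    unfolding bilin_def
    by (rule member_le_sum[of 0 _ "\<lambda>i. \<Sum>j\<in>insert 0 S. H i j * w i * w j"])
      (use S Hnn w in \<open>auto intro!: sum_nonneg add_nonneg_nonneg mult_nonneg_nonneg intro: less_imp_le\<close>)
  finally have ww: "bilin (insert 0 S) H w w > 0" .
  show ?thesis
    by (rule negative_definite_on_orthogonal[OF sym neg ww orth nz])
qed

text \<open>Induction on \<open>d\<close> for all \<open>S\<close>, \<open>T\<close> and
  \<open>c\<close> at once, since a derivative by \<open>w i\<close> contracts \<open>i\<close> and
  shifts \<open>c\<close>. The inequality for \<open>c\<close> involves \<open>card S\<close> and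
  not the degree, so a derivative by \<open>w 0\<close> leaves it untouched.\<close>

lemma hessian_negative_definite:
  assumes M: "matroid E \<I>" and q: "0 < q" "q \<le> 1"
    and "finite S" "0 \<notin> S" "S \<union> T \<subseteq> E" "Suc (Suc d) \<le> card S"
    and "\<And>i. i \<in> insert 0 S \<Longrightarrow> w i > 0" "\<And>k. k \<le> card S \<Longrightarrow> c k > 0"
    and "\<And>m. 0 < m \<Longrightarrow> m < card S \<Longrightarrow> (c m)\<^sup>2 * (real (card S) - real m + 1) >
       c (m - 1) * c (m + 1) * (real (card S) - real m)"
    and "bilin (insert 0 S)
      (\<lambda>i j. partial i (partial j (gen_poly S (rank_weight q \<I> T) c (Suc (Suc d)))) w) x w = 0"
    and "\<exists>i\<in>insert 0 S. x i \<noteq> 0"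
  shows "bilin (insert 0 S)
      (\<lambda>i j. partial i (partial j (gen_poly S (rank_weight q \<I> T) c (Suc (Suc d)))) w) x x < 0"
  using assms(4-)
proof (induction d arbitrary: S T c x)
  case (0 S T c x)
  have lc: "(c 1)\<^sup>2 * real (card S) > c 0 * c 2 * (real (card S) - 1)"
    using 0(7)[of 1] 0(4) by (simp add: numeral_2_eq_2)
  show ?case
    by (rule hessian_negative_definite_degree_2[OF M 0(1-3) q 0(5) _ 0(6) lc 0(8,9)]) (use 0(4) in auto)
next
  case (Suc d S T c x)
  note S = Suc.prems(1,2) and w = Suc.prems(5) and c = Suc.prems(6)
  define r where "r = rank_weight q \<I> T"
  define F where "F = gen_poly S r c (Suc (Suc (Suc d)))"
  define V where "V = insert 0 S"
  define H where "H i j = partial i (partial j F) w" for i j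
  define K where "K i j k = partial j (partial k (partial i F)) w" for i j k
  have rpos: "r A > 0" for A using q by (simp add: r_def)
  have V: "finite V" "0 \<in> V" using S by (auto simp: V_def)
  have F: "gen_poly_class V (Suc (Suc (Suc d))) F"
    unfolding F_def V_def by (rule gen_poly_classI) (use S rpos c in auto)
  have F1: "gen_poly_class V (Suc (Suc d)) (partial i F)" for i
    by (rule gen_poly_class_partial[OF F])
  have F2: "gen_poly_class V (Suc d) (partial j (partial i F))" for i j
    by (rule gen_poly_class_partial[OF F1])
  have sym: "partial i (partial j F) = partial j (partial i F)" for i j
    by (rule gen_poly_class_commute[OF F])
  have sym1: "partial i (partial j (partial k F)) = partial j (partial i (partial k F))" for i j k
    by (rule gen_poly_class_commute[OF F1])
  have IH0: "bilin V (K 0) y y < 0" if "bilin V (K 0) y w = 0" "\<exists>i\<in>V. y i \<noteq> 0" for y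
  proof -
    have K0: "K 0 = (\<lambda>j k. partial j (partial k (gen_poly S (rank_weight q \<I> T) c (Suc (Suc d)))) w)"
      using S by (simp add: K_def F_def r_def partial_0_gen_poly fun_eq_iff)
    show ?thesis
      using that unfolding K0 V_def
      by (intro Suc.IH Suc.prems) (use Suc.prems(4) in auto)
  qed
  \<comment> \<open>Only a weak inequality on \<open>V\<close>: the variable \<open>i\<close> is
    absent from \<open>partial i F\<close>, so its Hessian has a zero row at \<open>i\<close> and
    the hypothesis applies on \<open>S - {i}\<close>.\<close>
  have IHi: "bilin V (K i) y y \<le> 0" if i: "i \<in> S" and orth: "bilin V (K i) y w = 0" for i y
  proof -
    have i0: "i \<noteq> 0" using i S by metis
    have cardS: "card S = Suc (card (S - {i}))" by (rule card_Suc_Diff1[symmetric]) (use S i in auto)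
    have pF: "partial i F = gen_poly (S - {i}) (rank_weight q \<I> (insert i T)) (\<lambda>k. c (Suc k)) (Suc (Suc d))"
      using S i by (simp add: F_def r_def partial_gen_poly)
    have zero: "partial i (partial i F) = (\<lambda>_. 0)"
      unfolding pF using i0 by (simp add: partial_other_gen_poly)
    have restr: "bilin V (K i) y z = bilin (insert 0 (S - {i})) (K i) y z" for y z
    proof (rule bilin_restrict[OF V(1)])
      show "insert 0 (S - {i}) \<subseteq> V" by (auto simp: V_def)
      fix j k assume "j \<in> V" "k \<in> V" "j \<notin> insert 0 (S - {i}) \<or> k \<notin> insert 0 (S - {i})"
      then have "j = i \<or> k = i" by (auto simp: V_def)
      then show "K i j k = 0"
        using sym1[of i k i] by (auto simp: K_def zero)
    qed
    have Ki: "K i = (\<lambda>j k. partial j (partial k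
        (gen_poly (S - {i}) (rank_weight q \<I> (insert i T)) (\<lambda>k. c (Suc k)) (Suc (Suc d)))) w)"
      by (simp add: K_def pF fun_eq_iff)
    show ?thesis
    proof (cases "\<exists>j\<in>insert 0 (S - {i}). y j \<noteq> 0")
      case True
      have "bilin (insert 0 (S - {i})) (K i) y y < 0"
        unfolding Ki
      proof (rule Suc.IH)
        show "bilin (insert 0 (S - {i})) (\<lambda>j k. partial j (partial k
          (gen_poly (S - {i}) (rank_weight q \<I> (insert i T)) (\<lambda>k. c (Suc k)) (Suc (Suc d)))) w) y w = 0"
          using orth unfolding restr unfolding Ki .
        show "c (Suc k) > 0" if "k \<le> card (S - {i})" for k
          using that by (intro c) (simp add: cardS)
        \<comment> \<open>The instance of the assumption at \<open>Suc m\<close>: index and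
          cardinality both drop by one, so their difference is preserved.\<close>
        show "c (Suc (m - 1)) * c (Suc (m + 1)) * (real (card (S - {i})) - real m)
           < (c (Suc m))\<^sup>2 * (real (card (S - {i})) - real m + 1)"
          if "0 < m" "m < card (S - {i})" for m
          using Suc.prems(7)[of "Suc m"] that by (simp add: cardS)
        show "Suc (Suc d) \<le> card (S - {i})" using Suc.prems(4) unfolding cardS by simp
        show "S - {i} \<union> insert i T \<subseteq> E" using Suc.prems(3) i by blast
        show "w j > 0" if "j \<in> insert 0 (S - {i})" for j using that by (intro w) auto
      qed (use S True in auto)
      then show ?thesis by (simp add: restr)
    next
      case False
      then have "bilin (insert 0 (S - {i})) (K i) y y = 0"
        unfolding bilin_def by (intro sum.neutral ballI) auto
      then show ?thesis by (simp add: restr)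
    qed
  qed
  have "bilin V H x x < 0"
  \<comment> \<open>\<open>e\<close> is the degree of the second derivatives of \<open>F\<close>,
    hence the factor in Euler's identity for them.\<close>
  proof (rule negative_definite_step[where V = V and v = 0 and w = w and K = K and e = "real (Suc d)"])
    show "w i > 0" if "i \<in> V" for i using w that by (simp add: V_def)
    show "H i j = H j i" for i j by (simp add: H_def sym[of i j])
    show "H i j \<ge> 0" for i j
      unfolding H_def by (rule gen_poly_class_nonneg[OF F2]) (use w in \<open>auto simp: V_def\<close>)
    show "H 0 j > 0" if "j \<in> V" for j
      unfolding H_def F_def
      by (rule hessian_gen_poly_row_0_pos[OF S w c rpos]) (use that in \<open>auto simp: V_def\<close>)
    show "K i j k = K i k j" for i j k by (simp add: K_def sym1[of j k i])
    show "(\<Sum>i\<in>V. w i * K i j k) = real (Suc d) * H j k" for j k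
    proof -
      have "K i j k = partial i (partial j (partial k F)) w" for i
        unfolding K_def sym[of k i] sym1[of j i k] ..
      then show ?thesis
        using gen_poly_class_Euler[OF F2 V(1), of w j k] by (simp add: H_def del: of_nat_Suc)
    qed
    show "(\<Sum>k\<in>V. K i j k * w k) = real (Suc d) * H i j" for i j
    proof -
      have "K i j k = partial k (partial j (partial i F)) w" for k
        unfolding K_def sym1[of j k i] ..
      then show ?thesis
        using gen_poly_class_Euler[OF F2 V(1), of w j i]
        by (simp add: H_def sym[of i j] mult.commute[of _ "w _"] del: of_nat_Suc)
    qed
    show "bilin V (K i) y y \<le> 0" if "i \<in> V" "bilin V (K i) y w = 0" for i y
    proof (cases "i = 0")
      case True
      show ?thesis
      proof (cases "\<exists>i\<in>V. y i \<noteq> 0")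
        case True
        then show ?thesis using IH0[of y] that \<open>i = 0\<close> by simp
      next
        case False
        then have "bilin V (K i) y y = 0" unfolding bilin_def by (intro sum.neutral ballI) auto
        then show ?thesis by simp
      qed
    next
      case False
      then show ?thesis using IHi that by (simp add: V_def)
    qed
    show "bilin V H x w = 0" using Suc.prems(8) by (simp add: H_def[abs_def] F_def r_def V_def)
    show "\<exists>i\<in>V. x i \<noteq> 0" using Suc.prems(9) by (simp add: V_def)
  qed (use V IH0 in auto)
  then show ?case by (simp add: H_def[abs_def] F_def r_def V_def)
qed

section \<open>Positive eigenvalues of real symmetric matrices\<close>

lemma of_real_char_poly:
  fixes A :: "real mat"
  assumes "A \<in> carrier_mat n n"
  shows "char_poly (map_mat complex_of_real A) = map_poly complex_of_real (char_poly A)"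
  by (rule of_real_hom.char_poly_hom[OF assms])

lemma eigenvalue_symmetric_real:
  fixes A :: "real mat"
  assumes A: "A \<in> carrier_mat n n"
    and sym: "\<And>i j. i < n \<Longrightarrow> j < n \<Longrightarrow> A $$ (i, j) = A $$ (j, i)"
    and ev: "eigenvalue (map_mat complex_of_real A) a"
  shows "cnj a = a"
proof -
  from ev obtain v where v: "v \<in> carrier_vec n" "v \<noteq> 0\<^sub>v n"
    and Av: "map_mat complex_of_real A *\<^sub>v v = a \<cdot>\<^sub>v v"
    using A unfolding eigenvalue_def eigenvector_def by auto
  have row: "(\<Sum>j<n. complex_of_real (A $$ (i, j)) * v $ j) = a * v $ i" if "i < n" for i
  proof -
    have "(map_mat complex_of_real A *\<^sub>v v) $ i = (\<Sum>j<n. complex_of_real (A $$ (i, j)) * v $ j)"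
      using A v that by (simp add: scalar_prod_def lessThan_atLeast0)
    then show ?thesis using v that by (simp add: Av)
  qed
  define s where "s = (\<Sum>i<n. \<Sum>j<n. complex_of_real (A $$ (i, j)) * v $ j * cnj (v $ i))"
  define N where "N = (\<Sum>i<n. v $ i * cnj (v $ i))"
  have "s = (\<Sum>i<n. (\<Sum>j<n. complex_of_real (A $$ (i, j)) * v $ j) * cnj (v $ i))"
    by (simp add: s_def sum_distrib_right)
  also have "\<dots> = a * N"
    by (simp add: row N_def sum_distrib_left mult.assoc)
  finally have s: "s = a * N" .
  have "cnj s = (\<Sum>i<n. \<Sum>j<n. complex_of_real (A $$ (i, j)) * cnj (v $ j) * v $ i)"
    by (simp add: s_def)
  also have "\<dots> = (\<Sum>j<n. \<Sum>i<n. complex_of_real (A $$ (i, j)) * cnj (v $ j) * v $ i)"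
    by (rule sum.swap)
  also have "\<dots> = s"
    unfolding s_def by (intro sum.cong refl) (simp add: sym mult_ac)
  finally have "cnj s = s" .
  moreover have N: "N = complex_of_real (\<Sum>i<n. (cmod (v $ i))\<^sup>2)"
    unfolding N_def of_real_sum by (intro sum.cong refl) (rule complex_norm_square[symmetric])
  ultimately have "cnj a * N = a * N" unfolding s by simp
  moreover have "N \<noteq> 0"
  proof
    assume "N = 0"
    then have "(\<Sum>i<n. (cmod (v $ i))\<^sup>2) = 0" unfolding N by (simp only: of_real_eq_0_iff)
    then have "\<forall>i<n. v $ i = 0" by (simp add: sum_nonneg_eq_0_iff)
    then have "v = 0\<^sub>v n" using v by (intro eq_vecI) auto
    then show False using v by simp
  qed
  ultimately show ?thesis by simp
qed

text \<open>The factorisation over the complex numbers descends because all its roots are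
  real.\<close>

lemma char_poly_symmetric_splits:
  fixes A :: "real mat"
  assumes A: "A \<in> carrier_mat n n"
    and sym: "\<And>i j. i < n \<Longrightarrow> j < n \<Longrightarrow> A $$ (i, j) = A $$ (j, i)"
  shows "\<exists>es. char_poly A = (\<Prod>e\<leftarrow>es. [:- e, 1:])"
proof -
  let ?A = "map_mat complex_of_real A"
  have A': "?A \<in> carrier_mat n n" using A by simp
  obtain as where as: "char_poly ?A = (\<Prod>a\<leftarrow>as. [:- a, 1:])"
    using char_poly_factorized[OF A'] by blast
  have real: "complex_of_real (Re a) = a" if "a \<in> set as" for a
  proof -
    have "poly (char_poly ?A) a = 0"
      using that unfolding as by (induction as) auto
    then have ev: "eigenvalue ?A a"
      using eigenvalue_root_char_poly[OF A'] by blast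
    have "cnj a = a"
      by (rule eigenvalue_symmetric_real[OF A _ ev]) (rule sym)
    then show ?thesis by (simp add: complex_eq_iff)
  qed
  interpret poly_hom: map_poly_inj_idom_hom complex_of_real ..
  have "map_poly complex_of_real (char_poly A) = (\<Prod>a\<leftarrow>as. [:- a, 1:])"
    using as of_real_char_poly[OF A] by simp
  also have "\<dots> = map_poly complex_of_real (\<Prod>e\<leftarrow>map Re as. [:- e, 1:])"
    using real
  proof (induction as)
    case (Cons a as)
    then have "complex_of_real (Re a) = a" by simp
    then have "map_poly complex_of_real [:- Re a, 1:] = [:- a, 1:]" by simp
    then show ?case
      using Cons by (simp only: list.map prod_list.Cons poly_hom.hom_mult) simp
  qed simp
  finally have eq: "map_poly complex_of_real (char_poly A) =
    map_poly complex_of_real (\<Prod>e\<leftarrow>map Re as. [:- e, 1:])" .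
  have "char_poly A = (\<Prod>e\<leftarrow>map Re as. [:- e, 1:])"
  proof (rule poly_eqI)
    fix k
    show "coeff (char_poly A) k = coeff (\<Prod>e\<leftarrow>map Re as. [:- e, 1:]) k"
      using arg_cong[OF eq, of "\<lambda>p. coeff p k"] by (simp only: coeff_map_poly of_real_0 of_real_eq_iff)
  qed
  then show ?thesis by blast
qed

lemma order_prod_linear:
  fixes es :: "real list"
  shows "Polynomial.order x (\<Prod>e\<leftarrow>es. [:- e, 1:]) = count_list es x"
proof -
  have "Polynomial.order x (\<Prod>e\<leftarrow>es. [:- e, 1:]) = (\<Sum>e\<leftarrow>es. Polynomial.order x [:- e, 1:])"
    by (subst order_prod_list) (auto simp: comp_def)
  also have "\<dots> = count_list es x"
    by (induction es) (auto simp: order_linear')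
  finally show ?thesis .
qed

lemma num_pos_eigenvalues_eq_length_filter:
  assumes A: "A \<in> carrier_mat n n" and es: "char_poly A = (\<Prod>e\<leftarrow>es. [:- e, 1:])"
  shows "num_pos_eigenvalues A = length (filter (\<lambda>e. 0 < e) es)"
proof -
  have ev: "eigenvalue A x \<longleftrightarrow> x \<in> set es" for x
  proof -
    have "poly (\<Prod>e\<leftarrow>es. [:- e, 1:]) x = 0 \<longleftrightarrow> x \<in> set es" by (induction es) auto
    then show ?thesis using eigenvalue_root_char_poly[OF A] es by simp
  qed
  have "num_pos_eigenvalues A = (\<Sum>x\<in>set (filter (\<lambda>e. 0 < e) es). count_list es x)"
    unfolding num_pos_eigenvalues_def
    by (rule sum.cong) (auto simp: ev es order_prod_linear)
  also have "\<dots> = (\<Sum>x\<in>set (filter (\<lambda>e. 0 < e) es). count_list (filter (\<lambda>e. 0 < e) es) x)"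
  proof (intro sum.cong refl)
    fix x assume "x \<in> set (filter (\<lambda>e. 0 < e) es)"
    then have "0 < x" by simp
    then show "count_list es x = count_list (filter (\<lambda>e. 0 < e) es) x" by (induction es) auto
  qed
  also have "\<dots> = length (filter (\<lambda>e. 0 < e) es)" by (rule sum_count_set) auto
  finally show ?thesis .
qed

text \<open>Triangularisation preserves the trace. A positive trace will yield the existence of a
  positive eigenvalue.\<close>

lemma trace_eq_sum_eigenvalues:
  fixes A :: "real mat"
  assumes A: "A \<in> carrier_mat n n" and es: "char_poly A = (\<Prod>e\<leftarrow>es. [:- e, 1:])"
  shows "(\<Sum>i<n. A $$ (i, i)) = sum_list es"
proof -
  obtain B P Q where dec: "schur_decomposition A es = (B, P, Q)" by (metis prod_cases3)
  note S = schur_decomposition[OF A es dec]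
  then have diag: "diag_mat B = es" by simp
  from S have "similar_mat_wit A B P Q" by simp
  note W = similar_mat_witD2[OF A this]
  define C where "C = P * B"
  have C: "C \<in> carrier_mat n n" using W(5,6) by (simp add: C_def)
  have "(\<Sum>i<n. A $$ (i, i)) = (\<Sum>i<n. \<Sum>k<n. C $$ (i, k) * Q $$ (k, i))"
    unfolding W(3) C_def[symmetric] using C W(7)
    by (intro sum.cong refl) (simp add: scalar_prod_def lessThan_atLeast0)
  also have "\<dots> = (\<Sum>k<n. \<Sum>i<n. Q $$ (k, i) * C $$ (i, k))"
    by (subst sum.swap) (simp add: mult.commute)
  also have "\<dots> = (\<Sum>k<n. (Q * C) $$ (k, k))"
    using C W(7)
    by (intro sum.cong refl) (simp add: scalar_prod_def lessThan_atLeast0)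
  also have "Q * C = Q * P * B"
    unfolding C_def by (rule assoc_mult_mat[symmetric]) (use W(5-7) in auto)
  also have "Q * P * B = B"
    using W(2,5) by simp
  also have "(\<Sum>k<n. B $$ (k, k)) = sum_list (diag_mat B)"
    using W(5) by (simp add: diag_mat_def sum_list_sum_nth lessThan_atLeast0)
  finally show ?thesis unfolding diag .
qed

text \<open>A Schur decomposition that starts with two positive eigenvalues \<open>a\<close>, \<open>b\<close> yields a plane
  on which the form is positive definite; such a plane meets the hyperplane orthogonal to \<open>u\<close>.\<close>

lemma at_most_one_positive_eigenvalue:
  fixes A :: "real mat"
  assumes A: "A \<in> carrier_mat n n"
    and sym: "\<And>i j. i < n \<Longrightarrow> j < n \<Longrightarrow> A $$ (i, j) = A $$ (j, i)"
    and nonpos: "\<And>x. (\<Sum>i<n. u i * x i) = 0 \<Longrightarrow> bilin {..<n} (\<lambda>i j. A $$ (i, j)) x x \<le> 0"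
    and es: "char_poly A = (\<Prod>e\<leftarrow>a # b # es. [:- e, 1:])" and ab: "a > 0" "b > 0"
  shows False
proof -
  obtain B P Q where dec: "schur_decomposition A (a # b # es) = (B, P, Q)" by (metis prod_cases3)
  note S = schur_decomposition[OF A es dec]
  then have upper: "upper_triangular B" and diag: "diag_mat B = a # b # es" by simp_all
  from S have "similar_mat_wit A B P Q" by simp
  note W = similar_mat_witD2[OF A this]
  have n: "n \<ge> 2"
    using arg_cong[OF diag, of length] W(5) by (simp add: diag_mat_def)
  have B00: "B $$ (0, 0) = a" and B11: "B $$ (1, 1) = b"
    using arg_cong[OF diag, of "\<lambda>l. l ! 0"] arg_cong[OF diag, of "\<lambda>l. l ! 1"] W(5) n
    by (simp_all add: diag_mat_def)
  have B0: "B $$ (k, 0) = 0" if "0 < k" "k < n" for k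
    using upper W(5) that by (simp add: upper_triangular_def)
  have B1: "B $$ (k, 1) = 0" if "1 < k" "k < n" for k
    using upper W(5) that by (simp add: upper_triangular_def)
  define H where "H i j = A $$ (i, j)" for i j
  define p where "p i = P $$ (i, 0)" for i
  define r where "r i = P $$ (i, 1)" for i
  define \<beta> where "\<beta> = B $$ (0, 1)"
  have AP: "A * P = P * B"
  proof -
    have "A * P = P * B * (Q * P)"
      unfolding W(3) by (rule assoc_mult_mat) (use W(5-7) in auto)
    also have "\<dots> = P * B" unfolding W(2) by (rule right_mult_one_mat) (use W(5-7) in auto)
    finally show ?thesis .
  qed
  have APk: "(\<Sum>j<n. H i j * P $$ (j, k)) = (\<Sum>l<n. P $$ (i, l) * B $$ (l, k))"
    if "i < n" "k < n" for i k
    using arg_cong[OF AP, of "\<lambda>M. M $$ (i, k)"] that W(4-7)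
    by (simp add: scalar_prod_def lessThan_atLeast0 H_def)
  have Hp: "(\<Sum>j<n. H i j * p j) = a * p i" if "i < n" for i
  proof -
    have "(\<Sum>j<n. H i j * p j) = (\<Sum>l<n. P $$ (i, l) * B $$ (l, 0))"
      using APk[OF that, of 0] n by (simp add: p_def)
    also have "\<dots> = (\<Sum>l\<in>{0}. P $$ (i, l) * B $$ (l, 0))"
      using n B0 by (intro sum.mono_neutral_right) auto
    finally show ?thesis by (simp add: p_def B00)
  qed
  have Hr: "(\<Sum>j<n. H i j * r j) = \<beta> * p i + b * r i" if "i < n" for i
  proof -
    have "(\<Sum>j<n. H i j * r j) = (\<Sum>l<n. P $$ (i, l) * B $$ (l, 1))"
      using APk[OF that, of 1] n by (simp add: r_def)
    also have "\<dots> = (\<Sum>l\<in>{0, 1}. P $$ (i, l) * B $$ (l, 1))"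
      using n B1 by (intro sum.mono_neutral_right) auto
    finally show ?thesis using B11 by (simp add: p_def r_def \<beta>_def)
  qed
  have QP: "(\<Sum>i<n. Q $$ (k, i) * P $$ (i, l)) = (if k = l then 1 else 0)" if "k < n" "l < n" for k l
    using arg_cong[OF W(2), of "\<lambda>M. M $$ (k, l)"] that W(4-7)
    by (simp add: scalar_prod_def lessThan_atLeast0)
  have sqpos: "(\<Sum>i<n. (y i)\<^sup>2) > 0" if nz: "\<exists>i<n. y i \<noteq> 0" for y :: "nat \<Rightarrow> real"
  proof -
    obtain i where i: "i < n" "y i \<noteq> 0" using nz by blast
    then have "0 < (y i)\<^sup>2" by simp
    also have "\<dots> \<le> (\<Sum>i<n. (y i)\<^sup>2)" by (rule member_le_sum) (use i in auto)
    finally show ?thesis .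
  qed
  have "\<exists>i<n. p i \<noteq> 0"
  proof (rule ccontr)
    assume "\<not> ?thesis"
    then have "(\<Sum>i<n. Q $$ (0, i) * P $$ (i, 0)) = 0"
      by (intro sum.neutral) (auto simp: p_def)
    then show False using QP[of 0 0] n by simp
  qed
  then have pp: "(\<Sum>i<n. (p i)\<^sup>2) > 0" by (rule sqpos)
  \<comment> \<open>Gram-Schmidt: \<open>s\<close> is \<open>r\<close> with its component along
    \<open>p\<close> removed.\<close>
  define t where "t = (\<Sum>i<n. p i * r i) / (\<Sum>i<n. (p i)\<^sup>2)"
  define s where "s i = r i - t * p i" for i
  have "\<exists>i<n. s i \<noteq> 0"
  proof (rule ccontr)
    assume "\<not> ?thesis"
    then have "P $$ (i, 1) = t * P $$ (i, 0)" if "i < n" for i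
      using that by (auto simp: s_def r_def p_def)
    then have "(\<Sum>i<n. Q $$ (1, i) * P $$ (i, 1)) = t * (\<Sum>i<n. Q $$ (1, i) * P $$ (i, 0))"
      unfolding sum_distrib_left by (intro sum.cong refl) auto
    then show False using QP[of 1 1] QP[of 1 0] n by simp
  qed
  then have ss: "(\<Sum>i<n. (s i)\<^sup>2) > 0" by (rule sqpos)
  have ps: "(\<Sum>i<n. p i * s i) = 0"
  proof -
    have "(\<Sum>i<n. p i * s i) = (\<Sum>i<n. p i * r i) - t * (\<Sum>i<n. (p i)\<^sup>2)"
      by (simp add: s_def sum_subtractf sum_distrib_left power2_eq_square algebra_simps)
    then show ?thesis using pp by (simp add: t_def)
  qed
  \<comment> \<open>Evaluating the symmetric form at \<open>r\<close> and \<open>p\<close> in both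
    ways determines the off-diagonal entry \<open>\<beta>\<close>; with this value \<open>s\<close>
    is an eigenvector for \<open>b\<close>.\<close>
  have "a * (\<Sum>i<n. p i * r i) = (\<Sum>i<n. r i * (a * p i))"
    by (simp add: sum_distrib_left mult_ac)
  also have "\<dots> = bilin {..<n} H r p"
    unfolding bilin_rows by (intro sum.cong refl) (simp add: Hp)
  also have "\<dots> = bilin {..<n} H p r"
    by (rule bilin_commute) (simp add: H_def sym)
  also have "\<dots> = (\<Sum>i<n. p i * (\<beta> * p i + b * r i))"
    unfolding bilin_rows by (intro sum.cong refl) (simp add: Hr)
  also have "\<dots> = \<beta> * (\<Sum>i<n. (p i)\<^sup>2) + b * (\<Sum>i<n. p i * r i)"
    by (simp add: sum_distrib_left sum.distrib power2_eq_square algebra_simps)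
  finally have \<beta>: "\<beta> = (a - b) * t" using pp by (simp add: t_def field_simps)
  have Hs: "(\<Sum>j<n. H i j * s j) = b * s i" if "i < n" for i
  proof -
    have "(\<Sum>j<n. H i j * s j) = (\<Sum>j<n. H i j * r j) - t * (\<Sum>j<n. H i j * p j)"
      by (simp add: s_def sum_subtractf sum_distrib_left algebra_simps)
    also have "\<dots> = \<beta> * p i + b * r i - t * (a * p i)" by (simp only: Hp[OF that] Hr[OF that])
    also have "\<dots> = b * s i" by (simp add: s_def \<beta> algebra_simps)
    finally show ?thesis .
  qed
  have form: "bilin {..<n} H (\<lambda>i. \<alpha> * p i + \<gamma> * s i) (\<lambda>i. \<alpha> * p i + \<gamma> * s i) =
      \<alpha>\<^sup>2 * a * (\<Sum>i<n. (p i)\<^sup>2) + \<gamma>\<^sup>2 * b * (\<Sum>i<n. (s i)\<^sup>2)" for \<alpha> \<gamma>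
  proof -
    have "(\<Sum>j<n. H i j * (\<alpha> * p j + \<gamma> * s j)) = \<alpha> * (a * p i) + \<gamma> * (b * s i)" if "i < n" for i
    proof -
      have "(\<Sum>j<n. H i j * (\<alpha> * p j + \<gamma> * s j)) =
        \<alpha> * (\<Sum>j<n. H i j * p j) + \<gamma> * (\<Sum>j<n. H i j * s j)"
        by (simp add: sum.distrib sum_distrib_left algebra_simps)
      then show ?thesis by (simp add: Hp Hs that)
    qed
    then have "bilin {..<n} H (\<lambda>i. \<alpha> * p i + \<gamma> * s i) (\<lambda>i. \<alpha> * p i + \<gamma> * s i) =
      (\<Sum>i<n. (\<alpha> * p i + \<gamma> * s i) * (\<alpha> * (a * p i) + \<gamma> * (b * s i)))"
      unfolding bilin_rows by (intro sum.cong refl) simp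
    also have "\<dots> = \<alpha>\<^sup>2 * a * (\<Sum>i<n. (p i)\<^sup>2) + \<gamma>\<^sup>2 * b * (\<Sum>i<n. (s i)\<^sup>2) +
        (\<alpha> * \<gamma> * (a + b)) * (\<Sum>i<n. p i * s i)"
      unfolding sum_distrib_left sum.distrib[symmetric]
      by (intro sum.cong refl) (simp add: power2_eq_square algebra_simps)
    finally show ?thesis by (simp add: ps)
  qed
  define up where "up = (\<Sum>i<n. u i * p i)"
  define us where "us = (\<Sum>i<n. u i * s i)"
  have lin: "(\<Sum>i<n. u i * (\<alpha> * p i + \<gamma> * s i)) = \<alpha> * up + \<gamma> * us" for \<alpha> \<gamma>
    by (simp add: up_def us_def sum.distrib sum_distrib_left algebra_simps)
  have le: "\<alpha>\<^sup>2 * a * (\<Sum>i<n. (p i)\<^sup>2) + \<gamma>\<^sup>2 * b * (\<Sum>i<n. (s i)\<^sup>2) \<le> 0"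
    if "\<alpha> * up + \<gamma> * us = 0" for \<alpha> \<gamma>
  proof -
    have "bilin {..<n} H (\<lambda>i. \<alpha> * p i + \<gamma> * s i) (\<lambda>i. \<alpha> * p i + \<gamma> * s i) \<le> 0"
      unfolding H_def by (rule nonpos) (simp only: lin that)
    then show ?thesis unfolding form .
  qed
  show False
  proof (cases "up = 0")
    case True
    then show False using le[of 1 0] mult_pos_pos[OF ab(1) pp] by simp
  next
    case False
    then have "0 < up\<^sup>2 * b * (\<Sum>i<n. (s i)\<^sup>2)" using ab ss by simp
    moreover have "0 \<le> us\<^sup>2 * a * (\<Sum>i<n. (p i)\<^sup>2)" using ab pp by simp
    \<comment> \<open>The combination \<open>us * p - up * s\<close> lies in the hyperplane of
      \<open>u\<close>.\<close>
    ultimately show False using le[of us "- up"] by simp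
  qed
qed

lemma num_pos_eigenvalues_eq_1:
  assumes A: "A \<in> carrier_mat n n"
    and sym: "\<And>i j. i < n \<Longrightarrow> j < n \<Longrightarrow> A $$ (i, j) = A $$ (j, i)"
    and nonpos: "\<And>x. (\<Sum>i<n. u i * x i) = 0 \<Longrightarrow> bilin {..<n} (\<lambda>i j. A $$ (i, j)) x x \<le> 0"
    and trace: "(\<Sum>i<n. A $$ (i, i)) > 0"
  shows "num_pos_eigenvalues A = 1"
proof -
  have "\<exists>es. char_poly A = (\<Prod>e\<leftarrow>es. [:- e, 1:])"
    by (rule char_poly_symmetric_splits[OF A]) (rule sym)
  then obtain es where es: "char_poly A = (\<Prod>e\<leftarrow>es. [:- e, 1:])" ..
  define ps where "ps = filter (\<lambda>e. 0 < e) es"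
  have num: "num_pos_eigenvalues A = length ps"
    unfolding ps_def by (rule num_pos_eigenvalues_eq_length_filter[OF A es])
  have "ps \<noteq> []"
  proof
    assume "ps = []"
    then have "\<forall>e\<in>set es. e \<le> 0" by (auto simp: ps_def filter_empty_conv not_less)
    then have "sum_list es \<le> 0" by (induction es) auto
    then show False using trace trace_eq_sum_eigenvalues[OF A es] by simp
  qed
  moreover have "length ps < 2"
  proof (rule ccontr)
    assume "\<not> ?thesis"
    then obtain a b ps' where ps: "ps = a # b # ps'"
      by (cases ps; cases "tl ps") auto
    \<comment> \<open>A Schur decomposition exists for every order of the eigenvalues, so the two
      positive ones are moved to the front.\<close>
    define es' where "es' = ps' @ filter (\<lambda>e. \<not> 0 < e) es"
    have "mset es = mset (a # b # es')"
    proof -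
      have "mset (a # b # es') = mset ps + mset (filter (\<lambda>e. \<not> 0 < e) es)"
        by (simp add: ps es'_def)
      also have "\<dots> = mset es"
        unfolding ps_def mset_filter by (rule multiset_partition[symmetric])
      finally show ?thesis ..
    qed
    then have "mset (map (\<lambda>e. [:- e, 1:]) es) = mset (map (\<lambda>e. [:- e, 1:]) (a # b # es'))"
      by (simp only: mset_map)
    then have cp: "char_poly A = (\<Prod>e\<leftarrow>a # b # es'. [:- e, 1:])"
      unfolding es by (metis prod_mset_prod_list)
    have "a \<in> set ps" "b \<in> set ps" by (simp_all add: ps)
    then have "a > 0" "b > 0" by (simp_all add: ps_def)
    show False
      by (rule at_most_one_positive_eigenvalue[OF A _ _ cp \<open>a > 0\<close> \<open>b > 0\<close>]) (rule sym nonpos; assumption)+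
  qed
  ultimately show ?thesis unfolding num by (cases ps) (auto simp: less_Suc_eq numeral_2_eq_2)
qed

section \<open>Invertibility of principal submatrices\<close>

lemma bij_betw_pick:
  assumes "finite V"
  shows "bij_betw (pick V) {..<card V} V"
proof -
  have inj: "inj_on (pick V) {..<card V}"
  proof (rule inj_onI)
    fix x y assume "x \<in> {..<card V}" "y \<in> {..<card V}" "pick V x = pick V y"
    then show "x = y"
      using pick_mono_le[of x V y] pick_mono_le[of y V x] by (metis lessThan_iff nat_neq_iff)
  qed
  have "pick V ` {..<card V} \<subseteq> V" using pick_in_set_le by auto
  then have "pick V ` {..<card V} = V"
    by (rule card_subset_eq[OF assms]) (simp add: card_image[OF inj])
  with inj show ?thesis by (simp add: bij_betw_def)
qed

lemma invertible_mat_submatrix: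
  fixes A :: "real mat"
  assumes A: "A \<in> carrier_mat N N" and V: "V \<subseteq> {..<N}"
    and ker: "\<And>x. (\<And>i. i \<in> V \<Longrightarrow> (\<Sum>j\<in>V. A $$ (i, j) * x j) = 0) \<Longrightarrow> \<forall>i\<in>V. x i = 0"
  shows "invertible_mat (submatrix A V V)"
proof -
  define M where "M = submatrix A V V"
  define m where "m = card V"
  have finV: "finite V" using V finite_subset by blast
  have Vi: "{i. i < N \<and> i \<in> V} = V" using V by auto
  have M: "M \<in> carrier_mat m m"
    using A by (auto simp: M_def m_def dim_submatrix Vi)
  have Mij: "M $$ (i, j) = A $$ (pick V i, pick V j)" if "i < m" "j < m" for i j
    unfolding M_def using A that by (subst submatrix_index) (simp_all add: Vi m_def)
  have "det M \<noteq> 0"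
  proof
    assume "det M = 0"
    then obtain v where v: "v \<in> carrier_vec m" "v \<noteq> 0\<^sub>v m" and Mv: "M *\<^sub>v v = 0\<^sub>v m"
      using det_0_iff_vec_prod_zero[OF M] by blast
    \<comment> \<open>The number of smaller elements of \<open>V\<close> is the position of
      \<open>i\<close> in \<open>V\<close>, so this inverts \<open>pick V\<close>.\<close>
    define x where "x i = v $ card {a \<in> V. a < i}" for i
    have xp: "x (pick V k) = v $ k" if "k < m" for k
      using that by (simp add: x_def m_def card_pick_le)
    have "(\<Sum>j\<in>V. A $$ (i, j) * x j) = 0" if "i \<in> V" for i
    proof -
      have "i \<in> pick V ` {..<m}" using bij_betw_pick[OF finV] that by (simp add: bij_betw_def m_def)
      then obtain k where k: "k < m" "i = pick V k" by auto
      have "(\<Sum>j\<in>V. A $$ (i, j) * x j) = (\<Sum>l<m. A $$ (i, pick V l) * x (pick V l))"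
        unfolding m_def by (rule sum.reindex_bij_betw[OF bij_betw_pick[OF finV], symmetric])
      also have "\<dots> = (\<Sum>l<m. M $$ (k, l) * v $ l)"
        by (intro sum.cong refl) (simp add: xp Mij k)
      also have "\<dots> = (M *\<^sub>v v) $ k"
        using M v k by (simp add: scalar_prod_def lessThan_atLeast0)
      finally show ?thesis using k by (simp add: Mv)
    qed
    then have x0: "\<forall>i\<in>V. x i = 0" by (rule ker)
    have "v $ k = 0" if "k < m" for k
      using x0 xp[OF that] pick_in_set_le[of k V] that by (simp add: m_def)
    then have "v = 0\<^sub>v m" using v by (intro eq_vecI) auto
    then show False using v by simp
  qed
  then have "M \<in> Units (ring_mat TYPE(real) m ())"
    by (rule det_non_zero_imp_unit[OF M])
  then obtain B where "B \<in> carrier_mat m m" "B * M = 1\<^sub>m m" "M * B = 1\<^sub>m m"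
    by (auto simp: Units_def ring_mat_def)
  then have "invertible_mat M"
    using M unfolding invertible_mat_def inverts_mat_def square_mat.simps by (auto intro!: exI[of _ B])
  then show ?thesis by (simp add: M_def)
qed

section \<open>Derivatives of the multivariate Tutte polynomial\<close>

lemma Z_poly_eq_gen_poly:
  "Z_poly n \<I> c q = gen_poly {1..n} (rank_weight q \<I> {}) (\<lambda>k. c k * fact (n - k)) n"
proof
  fix w :: "nat \<Rightarrow> real"
  define h where "h A = c (card A) * fact (n - card A) * rank_weight q \<I> {} A * (\<Prod>i\<in>A. w i) *
    (w 0 ^ (n - card A) / fact (n - card A))" for A
  have "Z_poly n \<I> c q w = (\<Sum>m = 0..n. c m * Z_hom n \<I> m q w * w 0 ^ (n - m))"
    unfolding Z_poly_def by (subst sum.atLeastAtMost_rev) (intro sum.cong, auto)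
  also have "\<dots> = (\<Sum>m\<in>{0..n}. sum h {A \<in> {A. A \<subseteq> {1..n} \<and> card A \<le> n}. card A = m})"
  proof (intro sum.cong refl)
    fix m assume m: "m \<in> {0..n}"
    then have "{A \<in> {A. A \<subseteq> {1..n} \<and> card A \<le> n}. card A = m} = {A. A \<subseteq> {1..n} \<and> card A = m}"
      by auto
    then show "c m * Z_hom n \<I> m q w * w 0 ^ (n - m) =
      sum h {A \<in> {A. A \<subseteq> {1..n} \<and> card A \<le> n}. card A = m}"
      unfolding Z_hom_def sum_distrib_left sum_distrib_right
      by (intro sum.cong) (auto simp: h_def)
  qed
  also have "\<dots> = sum h {A. A \<subseteq> {1..n} \<and> card A \<le> n}"
    by (rule sum.group) auto
  finally show "Z_poly n \<I> c q w =
      gen_poly {1..n} (rank_weight q \<I> {}) (\<lambda>k. c k * fact (n - k)) n w"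
    by (simp add: gen_poly_def h_def)
qed

section \<open>Iterated partial derivatives\<close>

lemma funpow_partial_zero: "(partial i ^^ k) (\<lambda>_. 0) = (\<lambda>_. 0)"
  by (induction k) auto

lemma funpow_partial_0_gen_poly:
  assumes "finite S" "0 \<notin> S"
  shows "(partial 0 ^^ k) (gen_poly S r c (d + k)) = gen_poly S r c d"
  using assms by (induction k) (simp_all add: funpow_Suc_right partial_0_gen_poly del: funpow.simps(2))

text \<open>\<open>U\<close> collects the variables differentiated once, that is, the contracted
  elements. The bound by \<open>d\<close> keeps the degree positive before each derivative.\<close>

lemma foldr_partial_gen_poly:
  assumes S: "finite S" "0 \<notin> S"
    and "distinct xs" "set xs \<subseteq> S" "\<forall>i\<in>set xs. \<alpha> i \<le> 1" "(\<Sum>i\<in>set xs. \<alpha> i) \<le> d"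
  defines "U \<equiv> \<lambda>xs. {i \<in> set xs. \<alpha> i = 1}"
  shows "foldr (\<lambda>i. partial i ^^ \<alpha> i) xs (gen_poly S r c d) =
    gen_poly (S - U xs) (\<lambda>A. r (A \<union> U xs)) (\<lambda>k. c (k + card (U xs))) (d - card (U xs))"
  using assms(3-6)
proof (induction xs)
  case Nil
  then show ?case by (simp add: U_def)
next
  case (Cons x xs)
  have IH: "foldr (\<lambda>i. partial i ^^ \<alpha> i) xs (gen_poly S r c d) =
    gen_poly (S - U xs) (\<lambda>A. r (A \<union> U xs)) (\<lambda>k. c (k + card (U xs))) (d - card (U xs))"
    using Cons by simp
  show ?case
  proof (cases "\<alpha> x = 1")
    case False
    then have "\<alpha> x = 0" using Cons.prems by auto
    moreover from this have "U (x # xs) = U xs" by (auto simp: U_def)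
    ultimately show ?thesis using IH by simp
  next
    case True
    have U: "U (x # xs) = insert x (U xs)" "x \<notin> U xs" "finite (U xs)"
      using True Cons.prems by (auto simp: U_def)
    have "card (U xs) = (\<Sum>i\<in>U xs. \<alpha> i)" by (simp add: U_def)
    also have "\<dots> \<le> (\<Sum>i\<in>set xs. \<alpha> i)" by (rule sum_mono2) (auto simp: U_def)
    finally have "Suc (card (U xs)) \<le> d" using Cons.prems True by simp
    then have d: "d - card (U xs) = Suc (d - card (U (x # xs)))" using U by simp
    have "x \<in> S - U xs" using Cons.prems U by auto
    then show ?thesis
      using S True U by (simp add: IH d partial_gen_poly Diff_insert[symmetric])
  qed
qed

text \<open>The polynomial has degree at most one in each variable of \<open>S\<close>.\<close>

lemma foldr_partial_gen_poly_zero: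
  assumes S: "finite S" "0 \<notin> S"
    and "distinct xs" "set xs \<subseteq> S" "\<exists>i\<in>set xs. \<alpha> i \<ge> 2" "(\<Sum>i\<in>set xs. \<alpha> i) \<le> d"
  shows "foldr (\<lambda>i. partial i ^^ \<alpha> i) xs (gen_poly S r c d) = (\<lambda>_. 0)"
  using assms(3-6)
proof (induction xs)
  case Nil
  then show ?case by simp
next
  case (Cons x xs)
  show ?case
  proof (cases "\<exists>i\<in>set xs. \<alpha> i \<ge> 2")
    case True
    then have "foldr (\<lambda>i. partial i ^^ \<alpha> i) xs (gen_poly S r c d) = (\<lambda>_. 0)"
      using Cons by simp
    then show ?thesis by (simp add: funpow_partial_zero)
  next
    case False
    \<comment> \<open>\<open>foldr\<close> works from the right, so \<open>x\<close> is the first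
      repeated variable met and the explicit formula still holds for \<open>xs\<close>.\<close>
    define U where "U = {i \<in> set xs. \<alpha> i = 1}"
    have "\<alpha> x \<ge> 2" using Cons.prems False by auto
    then obtain k where k: "\<alpha> x = Suc (Suc k)" by (metis add_2_eq_Suc le_Suc_ex)
    have "\<forall>i\<in>set xs. \<alpha> i \<le> 1" using False by (auto simp: not_le)
    then have eq: "foldr (\<lambda>i. partial i ^^ \<alpha> i) xs (gen_poly S r c d) =
        gen_poly (S - U) (\<lambda>A. r (A \<union> U)) (\<lambda>k. c (k + card U)) (d - card U)"
      unfolding U_def using Cons.prems by (intro foldr_partial_gen_poly[OF S]) auto
    have "card U = (\<Sum>i\<in>U. \<alpha> i)" by (simp add: U_def)
    also have "\<dots> \<le> (\<Sum>i\<in>set xs. \<alpha> i)" by (rule sum_mono2) (auto simp: U_def)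
    finally have "card U < d" using Cons.prems k by simp
    then obtain e where e: "d - card U = Suc e" by (metis Suc_diff_Suc)
    have "x \<in> S - U" using Cons.prems by (auto simp: U_def)
    moreover have "x \<noteq> 0" using Cons.prems S by (metis list.set_intros(1) subsetD)
    ultimately have "partial x (partial x (gen_poly (S - U) (\<lambda>A. r (A \<union> U)) (\<lambda>k. c (k + card U)) (Suc e))) = (\<lambda>_. 0)"
      using S by (simp add: partial_gen_poly partial_other_gen_poly)
    then show ?thesis
      by (simp add: eq e k funpow_Suc_right funpow_partial_zero del: funpow.simps(2))
  qed
qed

lemma partials_Z_poly:
  assumes \<alpha>: "(\<Sum>i\<le>n. \<alpha> i) + 2 \<le> n" and le1: "\<forall>i\<in>{1..n}. \<alpha> i \<le> 1"
  defines "U \<equiv> {i \<in> {1..n}. \<alpha> i = 1}"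
  shows "partials n \<alpha> (Z_poly n \<I> c q) =
    gen_poly ({1..n} - U) (rank_weight q \<I> U) (\<lambda>k. c (k + card U) * fact (n - (k + card U)))
      (n - card U - \<alpha> 0)"
    and "card U + \<alpha> 0 + 2 \<le> n"
proof -
  have split: "(\<Sum>i\<le>n. \<alpha> i) = \<alpha> 0 + (\<Sum>i\<in>{1..n}. \<alpha> i)"
    by (simp add: atMost_atLeast0 sum.atLeast_Suc_atMost)
  have "(\<Sum>i\<in>{1..n}. \<alpha> i) = (\<Sum>i\<in>U. \<alpha> i)"
    using le1 unfolding U_def by (intro sum.mono_neutral_right) (auto simp: le_Suc_eq)
  also have "\<dots> = card U" by (simp add: U_def)
  finally show card: "card U + \<alpha> 0 + 2 \<le> n" using \<alpha> split by simp
  \<comment> \<open>Index 0 heads the list, so the derivatives by \<open>w 0\<close> are applied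
    last, after all contractions.\<close>
  define xs where "xs = [Suc 0..<Suc n]"
  have xs: "set xs = {1..n}" "distinct xs" by (auto simp: xs_def)
  have U: "{i \<in> set xs. \<alpha> i = 1} = U" by (simp add: U_def xs)
  have "foldr (\<lambda>i. partial i ^^ \<alpha> i) xs (Z_poly n \<I> c q) =
     gen_poly ({1..n} - U) (\<lambda>A. rank_weight q \<I> {} (A \<union> U))
       (\<lambda>k. c (k + card U) * fact (n - (k + card U))) (n - card U)"
    unfolding Z_poly_eq_gen_poly U[symmetric]
    using le1 \<alpha> split xs by (intro foldr_partial_gen_poly) auto
  moreover have "n - card U = n - card U - \<alpha> 0 + \<alpha> 0" using card by simp
  ultimately show "partials n \<alpha> (Z_poly n \<I> c q) =
    gen_poly ({1..n} - U) (rank_weight q \<I> U) (\<lambda>k. c (k + card U) * fact (n - (k + card U)))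
      (n - card U - \<alpha> 0)"
    unfolding partials_def upt_conv_Cons[of 0 "Suc n", OF zero_less_Suc] xs_def[symmetric]
    using funpow_partial_0_gen_poly[of "{1..n} - U" "\<alpha> 0" "rank_weight q \<I> U" _ "n - card U - \<alpha> 0"]
    by simp
qed

lemma partials_Z_poly_zero:
  assumes \<alpha>: "(\<Sum>i\<le>n. \<alpha> i) + 2 \<le> n" and ge2: "i \<in> {1..n}" "\<alpha> i \<ge> 2"
  shows "partials n \<alpha> (Z_poly n \<I> c q) = (\<lambda>_. 0)"
proof -
  have split: "(\<Sum>i\<le>n. \<alpha> i) = \<alpha> 0 + (\<Sum>i\<in>{1..n}. \<alpha> i)"
    by (simp add: atMost_atLeast0 sum.atLeast_Suc_atMost)
  define xs where "xs = [Suc 0..<Suc n]"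
  have xs: "set xs = {1..n}" "distinct xs" by (auto simp: xs_def)
  have "foldr (\<lambda>i. partial i ^^ \<alpha> i) xs (Z_poly n \<I> c q) = (\<lambda>_. 0)"
    unfolding Z_poly_eq_gen_poly
    using \<alpha> split ge2 xs
    by (intro foldr_partial_gen_poly_zero) auto
  then show ?thesis
    unfolding partials_def upt_conv_Cons[of 0 "Suc n", OF zero_less_Suc] xs_def[symmetric]
    by (simp add: funpow_partial_zero)
qed

text \<open>Evaluation at the point with coordinate 1 at index 0 and 0 elsewhere leaves only the
  term of the empty set. The polynomial is positive there and vanishes at the origin, and changing
  coordinate \<open>i\<close> from 0 to 1 adds the positive value of the derivative by
  \<open>w i\<close>.\<close>

lemma occurring_vars_gen_poly:
  assumes S: "S \<subseteq> {1..n}" and d: "d > 0"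
    and c: "c 0 > 0" "c 1 > 0" and r: "\<And>A. r A > 0"
  shows "occurring_vars n (gen_poly S r c d) = insert 0 S"
proof -
  have fin: "finite S" "0 \<notin> S" using S finite_subset by auto
  obtain e where e: "d = Suc e" using d gr0_implies_Suc by blast
  have other: "i \<notin> occurring_vars n (gen_poly S r c d)" if "i \<notin> insert 0 S" for i
    using that by (auto simp: occurring_vars_def gen_poly_upd_other)
  have pos: "gen_poly S' r c' d' (\<lambda>j. if j = 0 then 1 else 0) = c' 0 * r {} / fact d'"
    if "finite S'" "0 \<notin> S'" for S' r c' d'
  proof -
    have "gen_poly S' r c' d' (\<lambda>j. if j = 0 then 1 else 0) =
      (\<Sum>A\<in>{{}}. c' (card A) * r A * (\<Prod>i\<in>A. if i = 0 then 1 else 0) * (1 ^ (d' - card A) / fact (d' - card A)))"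
      unfolding gen_poly_def
    proof (rule sum.mono_neutral_cong_right)
      show "\<forall>A\<in>{A. A \<subseteq> S' \<and> card A \<le> d'} - {{}}. c' (card A) * r A *
        (\<Prod>i\<in>A. if i = 0 then 1 else 0) * ((if (0::nat) = 0 then 1 else 0) ^ (d' - card A) / fact (d' - card A)) = (0::real)"
      proof
        fix A assume A: "A \<in> {A. A \<subseteq> S' \<and> card A \<le> d'} - {{}}"
        then obtain i where "i \<in> A" by blast
        moreover have "A \<subseteq> S'" using A by blast
        ultimately have "i \<in> A" "i \<noteq> 0" "finite A" using that finite_subset by (blast, metis subsetD, blast)
        then have "(\<Prod>i\<in>A. if i = 0 then 1 else 0) = (0::real)" by (intro prod_zero) auto
        then show "c' (card A) * r A * (\<Prod>i\<in>A. if i = 0 then 1 else 0) *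
          ((if (0::nat) = 0 then 1 else 0) ^ (d' - card A) / fact (d' - card A)) = (0::real)" by simp
      qed
    qed (use that in auto)
    then show ?thesis by simp
  qed
  define w where "w j = (if j = 0 then 1 else 0 :: real)" for j :: nat
  have "0 \<in> occurring_vars n (gen_poly S r c d)"
  proof -
    have "gen_poly S r c d (w(0 := 0)) = 0"
      unfolding gen_poly_def
    proof (intro sum.neutral ballI)
      fix A assume A: "A \<in> {A. A \<subseteq> S \<and> card A \<le> d}"
      show "c (card A) * r A * (\<Prod>i\<in>A. (w(0 := 0)) i) * ((w(0 := 0)) 0 ^ (d - card A) / fact (d - card A)) = 0"
      proof (cases "A = {}")
        case True
        then show ?thesis using d by simp
      next
        case False
        then obtain i where "i \<in> A" "finite A" using A fin finite_subset by blast
        then have "(\<Prod>i\<in>A. (w(0 := 0)) i) = 0" by (intro prod_zero) (auto simp: w_def)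
        then show ?thesis by simp
      qed
    qed
    moreover have "gen_poly S r c d w > 0"
      unfolding w_def[abs_def] using pos[OF fin] c r[of "{}"] by simp
    ultimately show ?thesis
      unfolding occurring_vars_def by (metis (mono_tags, lifting) le0 less_irrefl mem_Collect_eq)
  qed
  moreover have "i \<in> occurring_vars n (gen_poly S r c d)" if i: "i \<in> S" for i
  proof -
    have S': "finite (S - {i})" "0 \<notin> S - {i}" using fin by auto
    have "gen_poly (S - {i}) (\<lambda>A. r (insert i A)) (\<lambda>k. c (Suc k)) e w > 0"
      unfolding w_def[abs_def] pos[OF S'] using c r[of "{i}"] by simp
    then have "gen_poly S r c d (w(i := 1)) \<noteq> gen_poly S r c d (w(i := 0))"
      unfolding e gen_poly_upd[OF fin i] by simp
    moreover have "w(i := 1) = (w(i := 0))(i := 1)" by simp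
    ultimately show ?thesis
      unfolding occurring_vars_def using i S by (metis (mono_tags, lifting) atLeastAtMost_iff mem_Collect_eq subsetD)
  qed
  ultimately show ?thesis using other by blast
qed

text \<open>A nonzero derivative is homogeneous of degree \<open>n\<close> minus the sum of
  \<open>\<alpha>\<close>; below degree 2 its Hessian vanishes identically, so the statement is
  about degree at least 2.\<close>

theorem theorem2:
  fixes n :: nat and \<I> :: "nat set set" and c :: "nat \<Rightarrow> real" and \<alpha> :: "nat \<Rightarrow> nat"
  assumes "n > 1"
    and "matroid {1..n} \<I>"
    and "\<And>m. m \<le> n \<Longrightarrow> c m > 0"
    and "strictly_log_concave n c"
    and "\<exists>q>0. \<exists>w. partials n \<alpha> (Z_poly n \<I> c q) w \<noteq> 0"
    and "(\<Sum>i\<le>n. \<alpha> i) + 2 \<le> n"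
  shows "(\<forall>q w. 0 < q \<and> q \<le> 1 \<and> (\<forall>i\<le>n. w i > 0) \<longrightarrow>
            invertible_mat (reduced_hessian n (partials n \<alpha> (Z_poly n \<I> c q)) w))
       \<and> (\<forall>q w. 0 < q \<and> q \<le> 1 \<and> (\<forall>i\<le>n. w i > 0) \<longrightarrow>
            num_pos_eigenvalues (hessian n (partials n \<alpha> (Z_poly n \<I> c q)) w) = 1)"
proof -
  have le1: "\<forall>i\<in>{1..n}. \<alpha> i \<le> 1"
  proof (rule ccontr)
    assume "\<not> ?thesis"
    then obtain i where i: "i \<in> {1..n}" "\<alpha> i \<ge> 2" by force
    have "partials n \<alpha> (Z_poly n \<I> c q) = (\<lambda>_. 0)" for q
      by (rule partials_Z_poly_zero[OF assms(6) i])
    then show False using assms(5) by simp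
  qed
  define U where "U = {i \<in> {1..n}. \<alpha> i = 1}"
  define S where "S = {1..n} - U"
  define u where "u = card U"
  define d where "d = n - u - \<alpha> 0 - 2"
  define c' where "c' k = c (k + u) * fact (n - (k + u))" for k
  have u: "u + \<alpha> 0 + 2 \<le> n"
    unfolding u_def U_def by (rule partials_Z_poly(2)[OF assms(6) le1])
  have S: "finite S" "0 \<notin> S" "S \<subseteq> {1..n}" "S \<union> U \<subseteq> {1..n}" by (auto simp: S_def U_def)
  have cardS: "card S = n - u"
    unfolding S_def u_def by (subst card_Diff_subset) (auto simp: U_def)
  have F: "partials n \<alpha> (Z_poly n \<I> c q) = gen_poly S (rank_weight q \<I> U) c' (Suc (Suc d))" for q
  proof -
    have "n - card U - \<alpha> 0 = Suc (Suc d)" using u by (simp add: d_def u_def)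
    then show ?thesis
      using partials_Z_poly(1)[OF assms(6) le1, of \<I> c q, folded U_def]
      by (simp add: S_def c'_def[abs_def] u_def)
  qed
  have cpos: "c' k > 0" if "k \<le> card S" for k
    using that u assms(3)[of "k + u"] by (simp add: c'_def cardS)
  have lc: "(c' m)\<^sup>2 * (real (card S) - real m + 1) > c' (m - 1) * c' (m + 1) * (real (card S) - real m)"
    if m: "0 < m" "m < card S" for m
  proof -
    define e where "e = n - (m + u) - 1"
    have e: "n - (m + u) = Suc e" "n - (m - 1 + u) = Suc (Suc e)" "n - (m + 1 + u) = e"
      "real (card S) - real m = real (Suc e)"
      using m u by (auto simp: e_def cardS)
    \<comment> \<open>The factorials and linear factors on both sides multiply to this same number,
      which reduces the weighted inequality to strict log-concavity of \<open>c\<close>.\<close>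
    define g where "g = real (Suc (Suc e)) * (real (Suc e) * fact e) * (real (Suc e) * fact e)"
    have "(c (m + u))\<^sup>2 > c (m - 1 + u) * c (m + 1 + u)"
      using assms(4) m unfolding strictly_log_concave_def cardS
      by (auto dest!: spec[of _ "m + u"] simp: algebra_simps)
    then have "(c (m + u))\<^sup>2 * g > c (m - 1 + u) * c (m + 1 + u) * g"
      by (intro mult_strict_right_mono) (simp_all add: g_def del: of_nat_Suc)
    then show ?thesis
      unfolding c'_def e g_def by (simp add: power2_eq_square algebra_simps)
  qed
  have main: "invertible_mat (reduced_hessian n (partials n \<alpha> (Z_poly n \<I> c q)) w) \<and>
      num_pos_eigenvalues (hessian n (partials n \<alpha> (Z_poly n \<I> c q)) w) = 1"
    if q: "0 < q" "q \<le> 1" and w: "\<forall>i\<le>n. w i > 0" for q w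
  proof -
    define f where "f = gen_poly S (rank_weight q \<I> U) c' (Suc (Suc d))"
    define V where "V = insert 0 S"
    define A where "A = hessian n f w"
    define H where "H i j = partial i (partial j f) w" for i j
    have rpos: "rank_weight q \<I> U B > 0" for B using q by simp
    have V: "finite V" "V \<subseteq> {..<n + 1}" "0 \<in> V" using S by (auto simp: V_def)
    have wV: "w i > 0" if "i \<in> V" for i using w V(2) that by auto
    have A: "A \<in> carrier_mat (n + 1) (n + 1)" by (simp add: A_def hessian_def)
    have AH: "A $$ (i, j) = H i j" if "i < n + 1" "j < n + 1" for i j
      using that by (simp add: A_def hessian_def H_def)
    have cls: "gen_poly_class V (Suc (Suc d)) f"
      unfolding f_def V_def by (rule gen_poly_classI) (use S rpos cpos in auto)
    have sym: "H i j = H j i" for i j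
      unfolding H_def gen_poly_class_commute[OF cls, of i j] ..
    have nonneg: "H i j \<ge> 0" for i j
      unfolding H_def
      by (intro gen_poly_class_nonneg[OF gen_poly_class_partial[OF gen_poly_class_partial[OF cls]]] wV)
    have zero: "H i j = 0" if "i \<notin> V \<or> j \<notin> V" for i j
    proof -
      have "H k l = 0" if "l \<notin> V" for k l
        using that by (simp add: H_def f_def V_def partial_other_gen_poly)
      then show ?thesis using that sym[of i j] by auto
    qed
    have neg: "bilin V H x x < 0" if "bilin V H x w = 0" "\<exists>i\<in>V. x i \<noteq> 0" for x
      using that unfolding V_def H_def[abs_def] f_def
      by (intro hessian_negative_definite[OF assms(2) q S(1,2,4)])
        (use cardS d_def u wV cpos lc in \<open>auto simp: V_def\<close>)
    have restr: "bilin {..<n + 1} (\<lambda>i j. A $$ (i, j)) x y = bilin V H x y" for x y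
    proof -
      have "bilin {..<n + 1} (\<lambda>i j. A $$ (i, j)) x y = bilin {..<n + 1} H x y"
        unfolding bilin_def by (intro sum.cong refl) (simp add: AH)
      also have "\<dots> = bilin V H x y"
        by (rule bilin_restrict) (use V zero in auto)
      finally show ?thesis .
    qed
    have "invertible_mat (submatrix A V V)"
    proof (rule invertible_mat_submatrix[OF A V(2)])
      fix x assume "\<And>i. i \<in> V \<Longrightarrow> (\<Sum>j\<in>V. A $$ (i, j) * x j) = 0"
      moreover have "(\<Sum>j\<in>V. A $$ (i, j) * x j) = (\<Sum>j\<in>V. H i j * x j)" if "i \<in> V" for i
        using that V(2) by (intro sum.cong refl) (simp add: AH subset_eq)
      ultimately have rows: "(\<Sum>j\<in>V. H i j * x j) = 0" if "i \<in> V" for i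
        using that by simp
      then have ker: "bilin V H y x = 0" for y
        unfolding bilin_rows by (intro sum.neutral ballI) simp
      have "bilin V H x w = bilin V H w x"
        by (rule bilin_commute) (rule sym)
      then show "\<forall>i\<in>V. x i = 0" using neg[of x] ker[of x] ker[of w] by auto
    qed
    moreover have "occurring_vars n f = V"
      unfolding f_def V_def
      by (rule occurring_vars_gen_poly) (use S rpos cpos cardS u in auto)
    moreover have "num_pos_eigenvalues A = 1"
    \<comment> \<open>The functional is \<open>H w\<close>, so its hyperplane is the complement of
      \<open>w\<close>.\<close>
    proof (rule num_pos_eigenvalues_eq_1[OF A, where u = "\<lambda>i. \<Sum>j<n + 1. H i j * w j"])
      show "A $$ (i, j) = A $$ (j, i)" if "i < n + 1" "j < n + 1" for i j
        using that AH sym by simp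
      show "bilin {..<n + 1} (\<lambda>i j. A $$ (i, j)) x x \<le> 0"
        if "(\<Sum>i<n + 1. (\<Sum>j<n + 1. H i j * w j) * x i) = 0" for x
      proof (cases "\<exists>i\<in>V. x i \<noteq> 0")
        case True
        have "bilin V H x w = bilin {..<n + 1} (\<lambda>i j. A $$ (i, j)) x w" by (simp only: restr)
        also have "\<dots> = (\<Sum>i<n + 1. x i * (\<Sum>j<n + 1. H i j * w j))"
          unfolding bilin_rows by (intro sum.cong refl arg_cong2[of _ _ _ _ "(*)"]) (simp add: AH)
        finally have "bilin V H x w = 0" using that by (simp add: mult.commute)
        then show ?thesis unfolding restr using neg[OF _ True] by (simp add: less_imp_le)
      next
        case False
        then have "bilin V H x x = 0" unfolding bilin_def by (intro sum.neutral ballI) auto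
        then show ?thesis by (simp only: restr)
      qed
      \<comment> \<open>All diagonal entries are nonnegative and this one is positive, so the trace
        is positive.\<close>
      have "0 < H 0 0"
        unfolding H_def f_def
        by (rule hessian_gen_poly_row_0_pos) (use S wV rpos cpos in \<open>auto simp: V_def\<close>)
      also have "\<dots> \<le> (\<Sum>i<n + 1. H i i)"
        by (rule member_le_sum) (use nonneg in auto)
      finally show "(\<Sum>i<n + 1. A $$ (i, i)) > 0" by (simp add: AH)
    qed
    ultimately show ?thesis
      by (simp add: F reduced_hessian_def f_def[symmetric] A_def[symmetric])
  qed
  then show ?thesis by blast
qed

end
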